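(* Let $\alpha,\beta>-1$ and $\gamma,\eta$ be real numbers with $\alpha>2\gamma+1$. Then, for integers $m,n$ such that $n>2\eta-\beta-1$ and $0\le m<(\alpha-1-2\gamma)/2$, the following assertions hold. (i) The function $\psi^{\gamma,\eta}_{m,n}$ is an $L^{2,\alpha}_\beta(\mathbb{D})$-eigenfunction of the operator $\mathcal{L}^{\alpha,\beta,+}_{\gamma,\eta}$ with corresponding eigenvalue $E^{\gamma,\alpha}_m=(m+1)(\alpha-2\gamma-m)$. (ii) The functions $\psi^{\gamma,\eta}_{m,n}$ form an orthogonal system in the Hilbert space $L^{2,\alpha}_\beta(\mathbb{D})$ and their square norm is given by $$\|\psi^{\gamma,\eta}_{m,n}\|^2_{\alpha,\beta}=\frac{\pi\, m!}{\alpha-2(\gamma+m)-1}\cdot\frac{\Gamma(\alpha-2\gamma-m)\,\Gamma(n+\beta-2\eta+1)}{\Gamma(n+\alpha+\beta-2(\gamma+\eta+m))}.$$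
   Context: Let $\mathbb{D}=\{z\in\mathbb{C}:|z|<1\}$ and $\mathbb{D}^*=\mathbb{D}\setminus\{0\}$; $\partial/\partial z$ and $\partial/\partial\bar z$ are the Wirtinger derivatives and $\Gamma$ is the Euler Gamma function. For $\alpha,\beta>-1$, $L^{2,\alpha}_\beta(\mathbb{D})$ is the Hilbert space of complex-valued functions on $\mathbb{D}$ that are square integrable with respect to $d\mu_{\alpha,\beta}(z)=(1-|z|^2)^\alpha|z|^{2\beta}\,dx\,dy$ ($z=x+iy$), with inner product $\langle f,g\rangle_{\alpha,\beta}=\int_{\mathbb{D}}f\bar g\,d\mu_{\alpha,\beta}$ and norm $\|\cdot\|_{\alpha,\beta}$. For real $a,b$ put $h_{a,b}(z)=(1-|z|^2)^a|z|^{2b}$. Define first order differential operators on $\mathbb{D}^*$ by $$A_{\gamma,\eta}f=h_{1-\gamma,-\eta}\frac{\partial}{\partial\bar z}(h_{\gamma,\eta}f),\qquad A^{*_{\alpha,\beta}}_{\gamma,\eta}f=-h_{\gamma-\alpha,\eta-\beta}\frac{\partial}{\partial z}(h_{\alpha-\gamma+1,\beta-\eta}f),$$ the second being the formal adjoint of the first with respect to $\langle\cdot,\cdot\rangle_{\alpha,\beta}$, and set $\mathcal{L}^{\alpha,\beta,+}_{\gamma,\eta}=A_{\gamma,\eta}A^{*_{\alpha,\beta}}_{\gamma,\eta}$. The $\beta$-restricted Zernike functions are $$\psi^{\gamma,\eta}_{m,n}(z,\bar z)=(-1)^m z^{\eta-\beta}\bar z^{-\eta}(1-|z|^2)^{\gamma-\alpha+m}\frac{\partial^m}{\partial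 z^m}\Big(z^{n+\beta-2\eta}(1-|z|^2)^{\alpha-2\gamma-m-1}\Big),\quad z\in\mathbb{D}^*,$$ where non-integer powers are taken with one common local branch, so that the single-valued expression $\psi^{\gamma,\eta}_{m,n}=(-1)^m h_{\gamma-\alpha+m,\eta-\beta}\,\frac{\partial^m}{\partial z^m}\big(z^n h_{\alpha-2\gamma-m-1,\beta-2\eta}\big)$ is obtained.
   Formalization: L² membership, orthogonality and norm are claimed only if 2η−β is an integer or n>2η−β−1+m; for the other indices (e.g. α=4, β=γ=0, η=1/4, m=1, n=0) ψ is not square integrable, so the claim fails. The pointwise eigenvalue equation is kept for all indices. *)

theory Defs
  imports "HOL-Analysis.Analysis"
begin

abbreviation unit_disc :: "complex set" where
  "unit_disc \<equiv> ball 0 1"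

abbreviation punctured_disc :: "complex set" where
  "punctured_disc \<equiv> ball 0 1 - {0}"

text \<open>
  Wirtinger derivatives: the partial derivatives along the x- and y-axis are the values of
  the real Frechet derivative in the directions 1 and \<open>\<i>\<close>.  They have their classical meaning
  wherever the function is real differentiable, which is the case at all points of
  \<^term>\<open>punctured_disc\<close> for the functions considered below.
\<close>

definition d_z :: "(complex \<Rightarrow> complex) \<Rightarrow> complex \<Rightarrow> complex" where
  "d_z f z = (frechet_derivative f (at z) 1 - \<i> * frechet_derivative f (at z) \<i>) / 2"

definition d_zbar :: "(complex \<Rightarrow> complex) \<Rightarrow> complex \<Rightarrow> complex" where
  "d_zbar f z = (frechet_derivative f (at z) 1 + \<i> * frechet_derivative f (at z) \<i>) / 2"

definition h :: "real \<Rightarrow> real \<Rightarrow> complex \<Rightarrow> real" where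
  "h a b z = (1 - (cmod z)\<^sup>2) powr a * cmod z powr (2 * b)"

definition A_op :: "real \<Rightarrow> real \<Rightarrow> (complex \<Rightarrow> complex) \<Rightarrow> complex \<Rightarrow> complex" where
  "A_op \<gamma> \<eta> f z =
     of_real (h (1 - \<gamma>) (- \<eta>) z) * d_zbar (\<lambda>w. of_real (h \<gamma> \<eta> w) * f w) z"

definition A_adj ::
  "real \<Rightarrow> real \<Rightarrow> real \<Rightarrow> real \<Rightarrow> (complex \<Rightarrow> complex) \<Rightarrow> complex \<Rightarrow> complex" where
  "A_adj \<alpha> \<beta> \<gamma> \<eta> f z =
     - (of_real (h (\<gamma> - \<alpha>) (\<eta> - \<beta>) z) *
        d_z (\<lambda>w. of_real (h (\<alpha> - \<gamma> + 1) (\<beta> - \<eta>) w) * f w) z)"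

definition L_plus ::
  "real \<Rightarrow> real \<Rightarrow> real \<Rightarrow> real \<Rightarrow> (complex \<Rightarrow> complex) \<Rightarrow> complex \<Rightarrow> complex" where
  "L_plus \<alpha> \<beta> \<gamma> \<eta> f = A_op \<gamma> \<eta> (A_adj \<alpha> \<beta> \<gamma> \<eta> f)"

text \<open>
  The single-valued form of the restricted Zernike functions, which needs no branch of a
  non-integer power of z.  The index n may be negative.
\<close>

definition zernike ::
  "real \<Rightarrow> real \<Rightarrow> real \<Rightarrow> real \<Rightarrow> nat \<Rightarrow> int \<Rightarrow> complex \<Rightarrow> complex" where
  "zernike \<alpha> \<beta> \<gamma> \<eta> m n z =
     (- 1) ^ m * of_real (h (\<gamma> - \<alpha> + real m) (\<eta> - \<beta>) z) *
     (d_z ^^ m) (\<lambda>w. w powi n * of_real (h (\<alpha> - 2 * \<gamma> - real m - 1) (\<beta> - 2 * \<eta>) w)) z"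

definition mu :: "real \<Rightarrow> real \<Rightarrow> complex measure" where
  "mu \<alpha> \<beta> = density (lebesgue_on unit_disc) (\<lambda>z. ennreal (h \<alpha> \<beta> z))"

text \<open>
  Representatives of the elements of the weighted Hilbert space.  The value at the origin is
  immaterial, so functions given on \<^term>\<open>punctured_disc\<close> are covered.
\<close>

definition L2 :: "real \<Rightarrow> real \<Rightarrow> (complex \<Rightarrow> complex) set" where
  "L2 \<alpha> \<beta> = {f \<in> borel_measurable (mu \<alpha> \<beta>). integrable (mu \<alpha> \<beta>) (\<lambda>z. (cmod (f z))\<^sup>2)}"

definition L2_inner ::
  "real \<Rightarrow> real \<Rightarrow> (complex \<Rightarrow> complex) \<Rightarrow> (complex \<Rightarrow> complex) \<Rightarrow> complex" where
  "L2_inner \<alpha> \<beta> f g = (LINT z|mu \<alpha> \<beta>. f z * cnj (g z))"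

definition L2_norm :: "real \<Rightarrow> real \<Rightarrow> (complex \<Rightarrow> complex) \<Rightarrow> real" where
  "L2_norm \<alpha> \<beta> f = sqrt (Re (L2_inner \<alpha> \<beta> f f))"

definition eigenfunction_on ::
  "complex set \<Rightarrow> ((complex \<Rightarrow> complex) \<Rightarrow> complex \<Rightarrow> complex) \<Rightarrow> complex \<Rightarrow> (complex \<Rightarrow> complex) \<Rightarrow> bool" where
  "eigenfunction_on S T c f \<longleftrightarrow> (\<exists>z\<in>S. f z \<noteq> 0) \<and> (\<forall>z\<in>S. T f z = c * f z)"

definition index_range :: "real \<Rightarrow> real \<Rightarrow> real \<Rightarrow> real \<Rightarrow> (nat \<times> int) set" where
  "index_range \<alpha> \<beta> \<gamma> \<eta> =
     {(m, n). real_of_int n > 2 * \<eta> - \<beta> - 1 \<and> real m < (\<alpha> - 1 - 2 * \<gamma>) / 2}"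

text \<open>
  Put \<open>b = n + \<beta> - 2 \<eta>\<close>.  Near the origin the function with index (m, n) behaves like
  \<open>b (b - 1) \<dots> (b - m + 1)\<close> times a function of modulus \<open>\<bar>z\<bar> powr (b - m - \<beta>)\<close>, so the
  square of its modulus, weighted by \<open>\<bar>z\<bar> powr (2 \<beta>)\<close>, is integrable there
  iff \<open>b > m - 1\<close> or the coefficient vanishes.  In \<^const>\<open>index_range\<close>, where \<open>b > - 1\<close>, this
  means: \<open>b > m - 1\<close> or \<open>b\<close> is an integer.  For the remaining indices (they exist as soon as
  \<open>2 \<eta> - \<beta>\<close> is not an integer and \<open>m = 1\<close> is allowed) the function solves the eigenvalue
  equation but is not square integrable; for example, with \<open>\<alpha> = 4\<close>, \<open>\<beta> = \<gamma> = 0\<close>,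
  \<open>\<eta> = 1/4\<close> and (m, n) = (1, 0) it has modulus at least \<open>\<bar>z\<bar> powr (- 3/2) / 2\<close>.
\<close>

definition L2_index_range :: "real \<Rightarrow> real \<Rightarrow> real \<Rightarrow> real \<Rightarrow> (nat \<times> int) set" where
  "L2_index_range \<alpha> \<beta> \<gamma> \<eta> =
     {(m, n) \<in> index_range \<alpha> \<beta> \<gamma> \<eta>.
        2 * \<eta> - \<beta> \<in> \<int> \<or> real_of_int n > 2 * \<eta> - \<beta> - 1 + real m}"

end

theory Submission
  imports Defs "HOL-Computational_Algebra.Polynomial"
begin

text \<open>
  Write \<open>t = \<bar>z\<bar>\<^sup>2\<close> and \<open>x = t / (1 - t)\<close>.  Functions on the punctured disc of the form
  \<open>z\<^sup>l (1 - t)\<^sup>a t\<^sup>b P(x)\<close> with a polynomial \<open>P\<close> are closed under both Wirtinger derivatives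
  and under multiplication by \<open>h\<close>: a derivative only shifts \<open>l\<close> and the exponents and replaces
  \<open>P\<close> by \<open>(u + v x) P + x (1 + x) P'\<close>, because \<open>t dx/dt = x (1 + x)\<close>
  (\<open>d_z_polar_fun\<close>, \<open>d_zbar_polar_fun\<close>).  This turns every claim into one about polynomials.

  Put \<open>p = n - m + \<beta> - 2 \<eta>\<close> and \<open>N = \<alpha> - 2 \<gamma> - 1\<close>.  Iterating \<open>\<partial>/\<partial>z\<close> shows that the restricted
  Zernike function is, up to sign, \<open>z\<^sup>n\<^sup>-\<^sup>m (1 - t)\<^sup>-\<^sup>\<gamma>\<^sup>-\<^sup>1 t\<^sup>-\<^sup>\<eta> R(x)\<close>, where \<open>R\<close> is a Jacobi polynomial of
  degree \<open>m\<close> in disguise (\<open>zernike_polar_fun\<close>).  The operator acts on functions of this form by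
  \<open>R \<mapsto> - ((p - (N + 1) x) R + x (1 + x) R')'\<close>, so the eigenvalue equation is the hypergeometric
  equation of \<open>R\<close>, which is a two-term recurrence of its coefficients (\<open>zernike_poly_ode\<close>).

  For the inner products, rotations preserve the measure; therefore functions with different
  \<open>n - m\<close> are orthogonal (\<open>L2_inner_polar_fun_0\<close>).  If \<open>n - m = n' - m'\<close>, the integrand is radial, and since
  \<open>z \<mapsto> \<bar>z\<bar>\<^sup>2\<close> pushes area on the disc forward to \<open>\<pi> dt\<close> on the unit interval, the inner
  product is \<open>\<pi>\<close> times the integral of \<open>t\<^sup>p (1 - t)\<^sup>N\<^sup>-\<^sup>1 R(x) R\<^sub>1(x)\<close>.  Expanding gives Beta integrals.
  The moment of \<open>R\<close> against \<open>x\<^sup>k\<close> is, up to a factor that does not depend on the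
  summation index, an alternating binomial sum: for \<open>k < m\<close> of a polynomial of degree below \<open>m\<close>,
  hence zero, and for \<open>k = m\<close> of a polynomial divided by a linear one, which has a closed form
  (\<open>zernike_poly_Beta_moment\<close>).  If \<open>m' \<le> m\<close>, at most the leading coefficient of \<open>R\<^sub>1\<close> contributes, and it does so
  only for \<open>m' = m\<close>; this gives orthogonality and the norm.
\<close>

section \<open>Wirtinger calculus for powers times radial functions\<close>

text \<open>
  The weight \<open>h a b\<close> is kept separate from the polynomial so that multiplication by another
  \<open>h\<close> adds exponents; the variable \<open>t / (1 - t)\<close> keeps the polynomials free of further
  powers of \<open>1 - t\<close> when differentiating.
\<close>

definition polar_fun :: "int \<Rightarrow> real \<Rightarrow> real \<Rightarrow> real poly \<Rightarrow> complex \<Rightarrow> complex" where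
  "polar_fun l a b P z = z powi l * of_real (h a b z * poly P ((cmod z)\<^sup>2 / (1 - (cmod z)\<^sup>2)))"

lemma has_derivative_powi_radial:
  assumes "z \<noteq> 0" and "(G has_real_derivative D) (at ((cmod z)\<^sup>2))"
  shows "((\<lambda>w. w powi l * of_real (G ((cmod w)\<^sup>2))) has_derivative
     (\<lambda>k. k * (of_int l * z powi (l - 1)) * of_real (G ((cmod z)\<^sup>2)) + z powi l * of_real (D * (2 * (z \<bullet> k))))) (at z)"
proof -
  have sq: "((\<lambda>w::complex. (cmod w)\<^sup>2) has_derivative (\<lambda>k. 2 * (z \<bullet> k))) (at z)"
    unfolding power2_norm_eq_inner
    by (auto intro!: derivative_eq_intros simp: inner_commute)
  have "((\<lambda>w. G ((cmod w)\<^sup>2)) has_derivative (\<lambda>k. D * (2 * (z \<bullet> k)))) (at z)"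
    using has_derivative_compose[OF sq assms(2)[unfolded has_field_derivative_def]]
    by simp
  then have "((\<lambda>w. complex_of_real (G ((cmod w)\<^sup>2))) has_derivative (\<lambda>k. of_real (D * (2 * (z \<bullet> k))))) (at z)"
    by (rule has_derivative_of_real)
  from has_derivative_mult[OF has_derivative_power_int'[OF assms(1)] this]
  show ?thesis
    by (simp add: add.commute)
qed

text \<open>
  The power is holomorphic, so only \<open>\<partial>/\<partial>z\<close> acts on it.  Since \<open>\<bar>z\<bar>\<^sup>2\<close> is the product of \<open>z\<close>
  and its conjugate, the radial factor contributes \<open>G'\<close> times the conjugate under \<open>\<partial>/\<partial>z\<close> and \<open>G'\<close>
  times \<open>z\<close> under the other derivative; the conjugate is absorbed by lowering the power by one
  and multiplying by \<open>\<bar>z\<bar>\<^sup>2\<close>.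
\<close>

lemma wirtinger_powi_radial:
  assumes "z \<noteq> 0" and "(G has_real_derivative D) (at ((cmod z)\<^sup>2))"
  shows "d_z (\<lambda>w. w powi l * of_real (G ((cmod w)\<^sup>2))) z =
           z powi (l - 1) * of_real (of_int l * G ((cmod z)\<^sup>2) + (cmod z)\<^sup>2 * D)" (is ?A)
    and "d_zbar (\<lambda>w. w powi l * of_real (G ((cmod w)\<^sup>2))) z = z powi (l + 1) * of_real D" (is ?B)
proof -
  note fd = frechet_derivative_at[OF has_derivative_powi_radial[OF assms, of l], symmetric]
  have cz: "complex_of_real (Re z) - \<i> * of_real (Im z) = cnj z" "complex_of_real (Re z) + \<i> * of_real (Im z) = z"
    by (auto simp: complex_eq_iff)
  have sq: "complex_of_real ((cmod z)\<^sup>2) = z * cnj z"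
    by (rule complex_norm_square)
  have l1: "z powi l = z powi (l - 1) * z" "z powi (l + 1) = z powi l * z"
    using power_int_add_1[of z "l - 1"] power_int_add_1[of z l] assms(1) by auto
  have "d_z (\<lambda>w. w powi l * of_real (G ((cmod w)\<^sup>2))) z =
      of_int l * z powi (l - 1) * of_real (G ((cmod z)\<^sup>2)) + z powi l * of_real D * (of_real (Re z) - \<i> * of_real (Im z))"
    unfolding d_z_def fd by (simp add: field_simps)
  also have "\<dots> = z powi (l - 1) * of_real (of_int l * G ((cmod z)\<^sup>2) + (cmod z)\<^sup>2 * D)"
    unfolding cz of_real_add of_real_mult sq of_real_of_int_eq l1 by (simp add: algebra_simps)
  finally show ?A .
  have "d_zbar (\<lambda>w. w powi l * of_real (G ((cmod w)\<^sup>2))) z =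
      z powi l * of_real D * (of_real (Re z) + \<i> * of_real (Im z))"
    unfolding d_zbar_def fd by (simp add: field_simps)
  then show ?B
    unfolding cz l1 by (simp add: algebra_simps)
qed

text \<open>
  At the origin both sides vanish because \<open>0 powr b = 0\<close>, also for \<open>b = 0\<close>.
\<close>

lemma h_squared_modulus: "h a b z = (1 - (cmod z)\<^sup>2) powr a * ((cmod z)\<^sup>2) powr b"
  unfolding h_def by (cases "z = 0") (simp_all add: powr_powr flip: powr_numeral)

text \<open>
  The logarithmic derivative of the weight is \<open>b / t - a / (1 - t) = (b - a x) / t\<close>, and
  \<open>dx/dt = 1 / (1 - t)\<^sup>2 = x (1 + x) / t\<close>.
\<close>

lemma has_real_derivative_radial_profile:
  assumes "0 < t" "t < (1::real)"
  shows "((\<lambda>t. (1 - t) powr a * t powr b * poly P (t / (1 - t))) has_real_derivative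
     (1 - t) powr a * t powr (b - 1) * poly ([:b, - a:] * P + [:0, 1, 1:] * pderiv P) (t / (1 - t))) (at t)"
proof -
  define x where "x = t / (1 - t)"
  have tx: "t = x / (1 + x)" "1 - t = 1 / (1 + x)" "x > 0"
    using assms by (auto simp: x_def field_simps)
  have dx: "((\<lambda>t. t / (1 - t)) has_real_derivative 1 / (1 - t)\<^sup>2) (at t)"
    using assms by (auto intro!: derivative_eq_intros simp: field_simps power2_eq_square)
  have "((\<lambda>t. poly P (t / (1 - t))) has_real_derivative poly (pderiv P) x * (1 / (1 - t)\<^sup>2)) (at t)"
    using DERIV_chain2[OF poly_DERIV[of P] dx] by (simp add: x_def)
  note dP = this
  have "((\<lambda>t. (1 - t) powr a * t powr b) has_real_derivative
      - (a * (1 - t) powr (a - 1)) * t powr b + (1 - t) powr a * (b * t powr (b - 1))) (at t)"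
    using assms by (auto intro!: derivative_eq_intros)
  from DERIV_mult[OF this dP] have D: "((\<lambda>t. (1 - t) powr a * t powr b * poly P (t / (1 - t))) has_real_derivative
     (- (a * (1 - t) powr (a - 1)) * t powr b + (1 - t) powr a * (b * t powr (b - 1))) * poly P x
     + (1 - t) powr a * t powr b * (poly (pderiv P) x * (1 / (1 - t)\<^sup>2))) (at t)"
    by (simp add: x_def algebra_simps)
  have p1: "(1 - t) powr (a - 1) = (1 - t) powr a / (1 - t)" "t powr b = t powr (b - 1) * t"
    using assms by (auto simp: powr_diff)
  have "(- (a * (1 - t) powr (a - 1)) * t powr b + (1 - t) powr a * (b * t powr (b - 1))) * poly P x
     + (1 - t) powr a * t powr b * (poly (pderiv P) x * (1 / (1 - t)\<^sup>2)) =
     (1 - t) powr a * t powr (b - 1) * ((b - a * (t / (1 - t))) * poly P x + t / (1 - t)\<^sup>2 * poly (pderiv P) x)"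
    unfolding p1 by (simp add: algebra_simps)
  also have "t / (1 - t)\<^sup>2 = x * (1 + x)"
    using tx(3) unfolding tx by (simp add: field_simps power2_eq_square)
  also have "t / (1 - t) = x" by (simp add: x_def)
  also have "(b - a * x) * poly P x + x * (1 + x) * poly (pderiv P) x = poly ([:b, - a:] * P + [:0, 1, 1:] * pderiv P) x"
    by (simp add: algebra_simps)
  finally have E: "(- (a * (1 - t) powr (a - 1)) * t powr b + (1 - t) powr a * (b * t powr (b - 1))) * poly P x
     + (1 - t) powr a * t powr b * (poly (pderiv P) x * (1 / (1 - t)\<^sup>2)) =
     (1 - t) powr a * t powr (b - 1) * poly ([:b, - a:] * P + [:0, 1, 1:] * pderiv P) x" .
  show ?thesis using D unfolding E unfolding x_def .
qed

lemma polar_fun_eq_profile: "polar_fun l a b P = (\<lambda>w. w powi l * of_real ((\<lambda>t. (1 - t) powr a * t powr b * poly P (t / (1 - t))) ((cmod w)\<^sup>2)))"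
  by (simp add: polar_fun_def fun_eq_iff h_squared_modulus)

lemma punctured_disc_squared_modulus: "z \<in> punctured_disc \<Longrightarrow> 0 < (cmod z)\<^sup>2 \<and> (cmod z)\<^sup>2 < 1"
  by (auto simp: abs_square_less_1)

lemma d_z_polar_fun:
  assumes z: "z \<in> punctured_disc"
  shows "d_z (polar_fun l a b P) z = polar_fun (l - 1) a b ([:of_int l + b, - a:] * P + [:0, 1, 1:] * pderiv P) z"
proof -
  have t: "0 < (cmod z)\<^sup>2" "(cmod z)\<^sup>2 < 1" and z0: "z \<noteq> 0" using punctured_disc_squared_modulus[OF z] z by auto
  have "(cmod z)\<^sup>2 powr b = (cmod z)\<^sup>2 * (cmod z)\<^sup>2 powr (b - 1)"
    using t by (simp add: powr_diff)
  note e = this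
  show ?thesis
    unfolding polar_fun_eq_profile wirtinger_powi_radial(1)[OF z0 has_real_derivative_radial_profile[OF t]]
    unfolding e by (simp add: algebra_simps)
qed

lemma d_zbar_polar_fun:
  assumes z: "z \<in> punctured_disc"
  shows "d_zbar (polar_fun l a b P) z = polar_fun (l + 1) a (b - 1) ([:b, - a:] * P + [:0, 1, 1:] * pderiv P) z"
proof -
  have t: "0 < (cmod z)\<^sup>2" "(cmod z)\<^sup>2 < 1" and z0: "z \<noteq> 0" using punctured_disc_squared_modulus[OF z] z by auto
  show ?thesis
    unfolding polar_fun_eq_profile wirtinger_powi_radial(2)[OF z0 has_real_derivative_radial_profile[OF t]] ..
qed

lemma h_mult_polar_fun: "of_real (h a' b' z) * polar_fun l a b P z = polar_fun l (a' + a) (b' + b) P z"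
  by (simp add: polar_fun_def h_def powr_add algebra_simps)

text \<open>
  The formulas for iterated derivatives are valid only on the punctured disc; locality makes
  that enough to differentiate once more.
\<close>

lemma wirtinger_cong_open:
  assumes "open S" "z \<in> S" "\<And>w. w \<in> S \<Longrightarrow> f w = g w"
  shows "d_z f z = d_z g z" "d_zbar f z = d_zbar g z"
proof -
  have "(f has_derivative D) (at z) \<longleftrightarrow> (g has_derivative D) (at z)" for D
    using has_derivative_transform_within_open[OF _ assms(1,2), of f D UNIV g]
      has_derivative_transform_within_open[OF _ assms(1,2), of g D UNIV f] assms(3) by auto
  then have "frechet_derivative f (at z) = frechet_derivative g (at z)"
    unfolding frechet_derivative_def by simp
  then show "d_z f z = d_z g z" "d_zbar f z = d_zbar g z" by (simp_all add: d_z_def d_zbar_def)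
qed

lemma polar_fun_sign: "(-1) ^ m * polar_fun l a b P z = polar_fun l a b (smult ((-1) ^ m) P) z"
  by (simp add: polar_fun_def)

section \<open>The polynomial part of the restricted Zernike functions\<close>

text \<open>
  With \<open>P\<^sub>m\<close> for the polynomial \<open>zernike_poly b c m\<close>, the Leibniz rule gives the Rodrigues-type formula
  \<open>(d/dt)\<^sup>m (t\<^sup>b (1 - t)\<^sup>c) = t\<^sup>b\<^sup>-\<^sup>m (1 - t)\<^sup>c P\<^sub>m(t / (1 - t))\<close>.
  The product of the two falling factorials with the binomial coefficient is written with
  generalized binomial coefficients, whose recurrences are convenient below.
\<close>

definition zernike_poly :: "real \<Rightarrow> real \<Rightarrow> nat \<Rightarrow> real poly" where
  "zernike_poly b c m = (\<Sum>k\<le>m. monom ((- 1) ^ k * fact m * (b gchoose (m - k)) * (c gchoose k)) k)"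

lemma coeff_zernike_poly:
  "coeff (zernike_poly b c m) k = (if k \<le> m then (- 1) ^ k * fact m * (b gchoose (m - k)) * (c gchoose k) else 0)"
  unfolding zernike_poly_def coeff_sum by (simp add: sum.delta)

lemma coeff_first_order_operator: "coeff ([:u, v:] * P + [:0, 1, 1:] * pderiv P) k =
   (u + of_nat k) * coeff P k + (if k = 0 then 0 else (v + of_nat (k - 1)) * coeff P (k - 1))" for P :: "real poly"
  by (cases k; cases "k - 1") (auto simp: coeff_pderiv algebra_simps)

lemma gbinomial_Suc_right: "(a - of_nat k) * (a gchoose k) = of_nat (Suc k) * (a gchoose Suc k)" for a :: real
  using gbinomial_mult_1[of a k] by (simp add: algebra_simps)

text \<open>
  One more application of \<open>\<partial>/\<partial>z\<close>.  Both terms of the coefficient at \<open>x\<^sup>k\<close> are multiples of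
  \<open>(b gchoose (m + 1 - k)) (c gchoose k)\<close>, with factors \<open>m + 1 - k\<close> and \<open>k\<close>, which add up to
  the \<open>m + 1\<close> that completes the factorial.
\<close>

lemma zernike_poly_Suc:
  "zernike_poly b c (Suc m) = [:b - of_nat m, - c:] * zernike_poly b c m + [:0, 1, 1:] * pderiv (zernike_poly b c m)"
proof (rule poly_eqI)
  fix k
  consider "k = 0" | j where "k = Suc j" "j < m" | "k = Suc m" | "k > Suc m"
    by (metis Suc_lessI gr0_implies_Suc gr0I less_Suc_eq not_less_eq)
  then show "coeff (zernike_poly b c (Suc m)) k = coeff ([:b - of_nat m, - c:] * zernike_poly b c m + [:0, 1, 1:] * pderiv (zernike_poly b c m)) k"
  proof cases
    case 1
    then show ?thesis using gbinomial_Suc_right[of b m] unfolding coeff_first_order_operator by (simp add: coeff_zernike_poly)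
  next
    case 2
    define B where "B = (b gchoose (m - j))"
    have bm: "(b - of_nat m + of_nat k) * (b gchoose (m - k)) = of_nat (m - j) * B"
      using gbinomial_Suc_right[of b "m - k"] 2 by (simp add: B_def Suc_diff_Suc of_nat_diff algebra_simps)
    have cm: "(c - of_nat j) * (c gchoose j) = of_nat k * (c gchoose k)"
      using gbinomial_Suc_right[of c j] 2 by simp
    have "coeff ([:b - of_nat m, - c:] * zernike_poly b c m + [:0, 1, 1:] * pderiv (zernike_poly b c m)) k
      = (- 1) ^ k * fact m * (((b - of_nat m + of_nat k) * (b gchoose (m - k))) * (c gchoose k) + B * ((c - of_nat j) * (c gchoose j)))"
      unfolding coeff_first_order_operator using 2 by (simp add: coeff_zernike_poly B_def algebra_simps)
    also have "\<dots> = (- 1) ^ k * (fact m * of_nat (m - j + k)) * B * (c gchoose k)"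
      unfolding bm cm by (simp add: algebra_simps)
    also have "m - j + k = Suc m" using 2 by simp
    finally show ?thesis using 2 by (simp add: coeff_zernike_poly B_def mult.commute)
  next
    case 3
    have "coeff ([:b - of_nat m, - c:] * zernike_poly b c m + [:0, 1, 1:] * pderiv (zernike_poly b c m)) k
        = (- 1) ^ Suc m * fact m * ((c - of_nat m) * (c gchoose m))"
      unfolding coeff_first_order_operator using 3 by (simp add: coeff_zernike_poly algebra_simps)
    then show ?thesis unfolding gbinomial_Suc_right using 3 by (simp add: coeff_zernike_poly algebra_simps)
  next
    case 4
    then show ?thesis unfolding coeff_first_order_operator by (auto simp: coeff_zernike_poly)
  qed
qed

text \<open>
  The hypergeometric equation behind the eigenvalue problem.  At \<open>x\<^sup>k\<close> it says
  \<open>(k + 1) (p + k + 1) r\<^bsub>k+1\<^esub> = - (m - k) (N - m - k) r\<^sub>k\<close>, and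
  \<open>(m - k) (N - m - k) - (k + 1) (k - N - 1) = (m + 1) (N + 1 - m)\<close> is the eigenvalue.
\<close>

lemma zernike_poly_ode:
  fixes p N :: real and m :: nat
  defines "R \<equiv> zernike_poly (p + of_nat m) (N - of_nat m) m"
  shows "pderiv ([:p, - (N + 1):] * R + [:0, 1, 1:] * pderiv R) = smult (- ((of_nat m + 1) * (N + 1 - of_nat m))) R"
proof (rule poly_eqI)
  fix k
  have *: "(p + of_nat (Suc k)) * of_nat (Suc k) * coeff R (Suc k) = - ((of_nat m - of_nat k) * (N - of_nat m - of_nat k)) * coeff R k"
  proof (cases "k < m")
    case True
    define B where "B = (p + of_nat m gchoose (m - k))"
    have bm: "(p + of_nat (Suc k)) * (p + of_nat m gchoose (m - Suc k)) = of_nat (m - k) * B"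
      using gbinomial_Suc_right[of "p + of_nat m" "m - Suc k"] True by (simp add: B_def Suc_diff_Suc of_nat_diff algebra_simps)
    have cm: "of_nat (Suc k) * (N - of_nat m gchoose Suc k) = (N - of_nat m - of_nat k) * (N - of_nat m gchoose k)"
      using gbinomial_Suc_right[of "N - of_nat m" k] by simp
    have "(p + of_nat (Suc k)) * of_nat (Suc k) * coeff R (Suc k) =
       - ((- 1) ^ k) * fact m * ((p + of_nat (Suc k)) * (p + of_nat m gchoose (m - Suc k))) * (of_nat (Suc k) * (N - of_nat m gchoose Suc k))"
      using True unfolding R_def coeff_zernike_poly by simp
    also have "\<dots> = - ((of_nat m - of_nat k) * (N - of_nat m - of_nat k)) * coeff R k"
      unfolding bm cm using True unfolding R_def coeff_zernike_poly B_def by (simp add: of_nat_diff algebra_simps)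
    finally show ?thesis .
  qed (auto simp: R_def coeff_zernike_poly)
  have "coeff (pderiv ([:p, - (N + 1):] * R + [:0, 1, 1:] * pderiv R)) k =
     of_nat (Suc k) * ((p + of_nat (Suc k)) * coeff R (Suc k) + (of_nat k - (N + 1)) * coeff R k)"
    unfolding coeff_pderiv coeff_first_order_operator by simp
  also have "\<dots> = (p + of_nat (Suc k)) * of_nat (Suc k) * coeff R (Suc k) + of_nat (Suc k) * (of_nat k - (N + 1)) * coeff R k"
    by (simp add: algebra_simps)
  also have "\<dots> = - ((of_nat m + 1) * (N + 1 - of_nat m)) * coeff R k"
    unfolding * by (simp add: algebra_simps)
  finally show "coeff (pderiv ([:p, - (N + 1):] * R + [:0, 1, 1:] * pderiv R)) k =
     coeff (smult (- ((of_nat m + 1) * (N + 1 - of_nat m))) R) k" by simp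
qed

lemma d_z_iterate_polar_fun:
  assumes "z \<in> punctured_disc"
  shows "(d_z ^^ m) (polar_fun n c s 1) z = polar_fun (n - int m) c s (zernike_poly (of_int n + s) c m) z"
  using assms
proof (induction m arbitrary: z)
  case 0
  have "zernike_poly (of_int n + s) c 0 = 1" by (simp add: zernike_poly_def monom_0 one_pCons)
  then show ?case by simp
next
  case (Suc m)
  have o: "open punctured_disc" by auto
  have "(d_z ^^ Suc m) (polar_fun n c s 1) z = d_z (polar_fun (n - int m) c s (zernike_poly (of_int n + s) c m)) z"
    using wirtinger_cong_open(1)[OF o Suc.prems Suc.IH] by simp
  also have "\<dots> = polar_fun (n - int (Suc m)) c s (zernike_poly (of_int n + s) c (Suc m)) z"
    unfolding d_z_polar_fun[OF Suc.prems] zernike_poly_Suc by (simp add: algebra_simps)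
  finally show ?case .
qed

text \<open>
  Here \<open>m\<close> derivatives leave the exponent of \<open>1 - t\<close> unchanged, so the final
  exponent \<open>(\<gamma> - \<alpha> + m) + (\<alpha> - 2 \<gamma> - m - 1)\<close> does not depend on \<open>m\<close>.
\<close>

lemma zernike_polar_fun:
  assumes "z \<in> punctured_disc"
  shows "zernike \<alpha> \<beta> \<gamma> \<eta> m n z = polar_fun (n - int m) (- \<gamma> - 1) (- \<eta>)
    (smult ((-1) ^ m) (zernike_poly (of_int n + \<beta> - 2 * \<eta>) (\<alpha> - 2 * \<gamma> - 1 - real m) m)) z"
proof -
  have "(\<lambda>w. w powi n * complex_of_real (h (\<alpha> - 2 * \<gamma> - real m - 1) (\<beta> - 2 * \<eta>) w)) = polar_fun n (\<alpha> - 2 * \<gamma> - 1 - real m) (\<beta> - 2 * \<eta>) 1"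
    by (simp add: polar_fun_def fun_eq_iff algebra_simps)
  then show ?thesis
    unfolding zernike_def polar_fun_sign[symmetric]
    by (simp add: d_z_iterate_polar_fun[OF assms] mult.assoc h_mult_polar_fun) (simp add: algebra_simps)
qed

lemma polar_fun_minus: "polar_fun l a b (- P) z = - polar_fun l a b P z"
  by (simp add: polar_fun_def)

text \<open>
  For these exponents \<open>a\<close> and \<open>b\<close> the weight is cancelled completely before
  \<open>\<partial>/\<partial>z\<^sup>*\<close> is applied (with \<open>z\<^sup>*\<close> the conjugate of \<open>z\<close>): only \<open>z\<^sup>l\<^sup>-\<^sup>1 W(x)\<close> remains, and its derivative is \<open>z\<^sup>l (1 - t)\<^sup>-\<^sup>2 W'(x)\<close>.
\<close>

lemma L_plus_polar_fun:
  assumes "\<And>w. w \<in> punctured_disc \<Longrightarrow> f w = polar_fun l (- \<gamma> - 1) (- \<eta>) P w"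
    and z: "z \<in> punctured_disc"
  shows "L_plus \<alpha> \<beta> \<gamma> \<eta> f z = polar_fun l (- \<gamma> - 1) (- \<eta>)
    (- pderiv ([:of_int l + \<beta> - 2 * \<eta>, - (\<alpha> - 2 * \<gamma>):] * P + [:0, 1, 1:] * pderiv P)) z"
proof -
  let ?W = "[:of_int l + \<beta> - 2 * \<eta>, - (\<alpha> - 2 * \<gamma>):] * P + [:0, 1, 1:] * pderiv P"
  have o: "open punctured_disc" by auto
  have 1: "A_adj \<alpha> \<beta> \<gamma> \<eta> f w = polar_fun (l - 1) (- \<gamma>) (- \<eta>) (- ?W) w" if w: "w \<in> punctured_disc" for w
  proof -
    have "d_z (\<lambda>w. of_real (h (\<alpha> - \<gamma> + 1) (\<beta> - \<eta>) w) * f w) w = d_z (polar_fun l (\<alpha> - 2 * \<gamma>) (\<beta> - 2 * \<eta>) P) w"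
      by (rule wirtinger_cong_open(1)[OF o w]) (subst assms(1), assumption, unfold h_mult_polar_fun, simp add: algebra_simps)
    then have "d_z (\<lambda>w. of_real (h (\<alpha> - \<gamma> + 1) (\<beta> - \<eta>) w) * f w) w = polar_fun (l - 1) (\<alpha> - 2 * \<gamma>) (\<beta> - 2 * \<eta>) ?W w"
      unfolding d_z_polar_fun[OF w] by (simp add: algebra_simps)
    moreover have "\<gamma> - \<alpha> + (\<alpha> - 2 * \<gamma>) = - \<gamma>" "\<eta> - \<beta> + (\<beta> - 2 * \<eta>) = - \<eta>" by simp_all
    ultimately show ?thesis unfolding A_adj_def polar_fun_minus by (simp only: h_mult_polar_fun)
  qed
  have "d_zbar (\<lambda>w. of_real (h \<gamma> \<eta> w) * A_adj \<alpha> \<beta> \<gamma> \<eta> f w) z = d_zbar (polar_fun (l - 1) 0 0 (- ?W)) z"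
    by (rule wirtinger_cong_open(2)[OF o z]) (simp add: 1 h_mult_polar_fun)
  also have "\<dots> = polar_fun l 0 (- 1) ([:0, 1, 1:] * pderiv (- ?W)) z"
    unfolding d_zbar_polar_fun[OF z] by simp
  also have "\<dots> = polar_fun l (- 2) 0 (pderiv (- ?W)) z"
  proof -
    have t: "0 < (cmod z)\<^sup>2" "(cmod z)\<^sup>2 < 1" using punctured_disc_squared_modulus[OF z] by auto
    define t where "t = (cmod z)\<^sup>2"
    have t1: "0 < t" "0 < 1 - t" using t by (auto simp: t_def)
    have "t powr (- 1) * (t / (1 - t) + t / (1 - t) * (t / (1 - t))) = 1 / (1 - t) + t / (1 - t)\<^sup>2"
      using t1 by (simp add: powr_minus field_simps power2_eq_square)
    also have "\<dots> = (1 - t) powr (- 2)"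
    proof -
      have "1 / u + (1 - u) / u\<^sup>2 = u powr (- 2)" if "u > 0" for u :: real
        using that by (simp add: powr_minus field_simps power2_eq_square)
      from this[OF t1(2)] show ?thesis by simp
    qed
    finally have K: "t powr (- 1) * poly [:0, 1, 1:] (t / (1 - t)) = (1 - t) powr (- 2)"
      by (simp add: distrib_left)
    have "(1 - t) powr 0 * t powr (- 1) * poly ([:0, 1, 1:] * Q) (t / (1 - t)) = (1 - t) powr (- 2) * t powr 0 * poly Q (t / (1 - t))" for Q
      unfolding poly_mult K[symmetric] using t1 by simp
    then show ?thesis unfolding polar_fun_def h_squared_modulus t_def[symmetric] by (simp only:)
  qed
  finally have F: "d_zbar (\<lambda>w. of_real (h \<gamma> \<eta> w) * A_adj \<alpha> \<beta> \<gamma> \<eta> f w) z = polar_fun l (- 2) 0 (pderiv (- ?W)) z" .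
  have "1 - \<gamma> + - 2 = - \<gamma> - 1" "- \<eta> + 0 = - \<eta>" by simp_all
  then show ?thesis
    unfolding L_plus_def A_op_def F h_mult_polar_fun pderiv_minus by (simp only:)
qed

section \<open>Alternating binomial sums and Beta moments\<close>

lemma alternating_sum_Suc:
  fixes f :: "nat \<Rightarrow> real"
  shows "(\<Sum>j\<le>Suc m. (- 1) ^ j * of_nat (Suc m choose j) * f j) =
    (\<Sum>j\<le>m. (- 1) ^ j * of_nat (m choose j) * f j) - (\<Sum>j\<le>m. (- 1) ^ j * of_nat (m choose j) * f (Suc j))"
proof -
  have "(\<Sum>j\<le>Suc m. (- 1) ^ j * of_nat (Suc m choose j) * f j) =
     f 0 + (\<Sum>j\<le>m. (- 1) ^ Suc j * of_nat (m choose Suc j) * f (Suc j)) - (\<Sum>j\<le>m. (- 1) ^ j * of_nat (m choose j) * f (Suc j))"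
    unfolding sum.atMost_Suc_shift by (simp add: algebra_simps sum.distrib sum_subtractf sum_negf)
  also have "f 0 + (\<Sum>j\<le>m. (- 1) ^ Suc j * of_nat (m choose Suc j) * f (Suc j)) =
     (\<Sum>j\<le>Suc m. (- 1) ^ j * of_nat (m choose j) * f j)"
    unfolding sum.atMost_Suc_shift by simp
  finally show ?thesis by simp
qed

text \<open>
  The sum is an \<open>m\<close>-th finite difference, and each difference lowers the degree.
\<close>

lemma alternating_sum_poly:
  fixes q :: "real poly"
  assumes "degree q < m"
  shows "(\<Sum>j\<le>m. (- 1) ^ j * of_nat (m choose j) * poly q (of_nat j)) = 0"
  using assms
proof (induction m arbitrary: q)
  case (Suc m)
  define r where "r = q - pcompose q [:1, 1:]"
  have r: "(\<Sum>j\<le>Suc m. (- 1) ^ j * of_nat (Suc m choose j) * poly q (of_nat j)) =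
      (\<Sum>j\<le>m. (- 1) ^ j * of_nat (m choose j) * poly r (of_nat j))"
    unfolding alternating_sum_Suc by (simp add: r_def poly_pcompose algebra_simps sum_subtractf)
  have "degree r \<le> degree q"
    unfolding r_def by (rule degree_diff_le) (auto simp: degree_pcompose)
  moreover have "coeff r (degree q) = 0"
    using lead_coeff_comp[of "[:1, 1:]" q] by (simp add: r_def degree_pcompose)
  ultimately have "r = 0 \<or> degree r < degree q"
    by (rule eq_zero_or_degree_less)
  then show ?case
    unfolding r using Suc.IH[of r] Suc.prems by auto
qed simp

text \<open>
  Read from right to left, this is the partial fraction expansion of the right-hand side.
\<close>

lemma alternating_sum_inverse:
  assumes "x > real m"
  shows "(\<Sum>j\<le>m. (- 1) ^ j * of_nat (m choose j) * (1 / (x - of_nat j))) = (- 1) ^ m * fact m / pochhammer (x - real m) (Suc m)"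
  using assms
proof (induction m arbitrary: x)
  case (Suc m)
  define y where "y = x - real (Suc m)"
  have y: "y > 0" using Suc.prems by (simp add: y_def)
  define A where "A = pochhammer y (Suc (Suc m))"
  have A0: "A > 0" unfolding A_def using y by (rule pochhammer_pos)
  have A: "A = y * pochhammer (y + 1) (Suc m)" "A = pochhammer y (Suc m) * (y + real (Suc m))"
    unfolding A_def by (rule pochhammer_rec, rule pochhammer_Suc)
  then have P: "pochhammer (y + 1) (Suc m) = A / y" "pochhammer y (Suc m) = A / (y + real (Suc m))"
    using y by (auto simp: field_simps)
  have "(\<Sum>j\<le>Suc m. (- 1) ^ j * of_nat (Suc m choose j) * (1 / (x - of_nat j))) =
    (\<Sum>j\<le>m. (- 1) ^ j * of_nat (m choose j) * (1 / (x - of_nat j))) - (\<Sum>j\<le>m. (- 1) ^ j * of_nat (m choose j) * (1 / ((x - 1) - of_nat j)))"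
    unfolding alternating_sum_Suc by (simp add: algebra_simps)
  also have "\<dots> = (- 1) ^ m * fact m / pochhammer (y + 1) (Suc m) - (- 1) ^ m * fact m / pochhammer y (Suc m)"
    using Suc.IH[of x] Suc.IH[of "x - 1"] Suc.prems by (simp add: y_def algebra_simps)
  also have "\<dots> = (- 1) ^ Suc m * fact (Suc m) / A"
    unfolding P using A0 y by (simp add: field_simps)
  finally show ?case unfolding A_def y_def .
qed simp

text \<open>
  Dividing \<open>q\<close> by \<open>y - x\<close> leaves the remainder \<open>q(x)\<close> and a quotient of degree below \<open>m\<close>,
  which the alternating sum annihilates.
\<close>

lemma alternating_sum_poly_divide:
  fixes q :: "real poly"
  assumes "degree q \<le> m" and "x > real m"
  shows "(\<Sum>j\<le>m. (- 1) ^ j * of_nat (m choose j) * (poly q (of_nat j) / (x - of_nat j))) =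
     poly q x * ((- 1) ^ m * fact m / pochhammer (x - real m) (Suc m))"
proof -
  have "poly (q - [:poly q x:]) x = 0" by simp
  then obtain g where g: "q - [:poly q x:] = [:- x, 1:] * g"
    unfolding poly_eq_0_iff_dvd by (elim dvdE)
  have "g = 0 \<or> degree g < m"
  proof (cases "g = 0")
    case False
    have "Suc (degree g) = degree (q - [:poly q x:])"
      unfolding g using False by (subst degree_mult_eq) auto
    also have "\<dots> \<le> m" using assms(1) by (intro degree_diff_le) auto
    finally show ?thesis by simp
  qed simp
  then have 0: "(\<Sum>j\<le>m. (- 1) ^ j * of_nat (m choose j) * poly g (of_nat j)) = 0"
    using alternating_sum_poly by auto
  have "poly q (of_nat j) / (x - of_nat j) = poly q x * (1 / (x - of_nat j)) - poly g (of_nat j)" if "j \<le> m" for j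
  proof -
    have "poly q (of_nat j) - poly q x = (of_nat j - x) * poly g (of_nat j)"
      using arg_cong[OF g, of "\<lambda>r. poly r (of_nat j)"] by (simp add: algebra_simps)
    then show ?thesis using that assms(2) by (simp add: field_simps)
  qed
  then have "(\<Sum>j\<le>m. (- 1) ^ j * of_nat (m choose j) * (poly q (of_nat j) / (x - of_nat j))) =
     (\<Sum>j\<le>m. poly q x * ((- 1) ^ j * of_nat (m choose j) * (1 / (x - of_nat j))) - (- 1) ^ j * of_nat (m choose j) * poly g (of_nat j))"
    by (intro sum.cong refl) (simp only: atMost_iff, simp add: right_diff_distrib)
  then show ?thesis
    unfolding sum_subtractf 0 sum_distrib_left[symmetric] alternating_sum_inverse[OF assms(2)] by simp
qed

lemma pochhammer_affine_poly:
  fixes u v :: real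
  shows "\<exists>q. degree q \<le> k \<and> (\<forall>y. poly q y = pochhammer (u + v * y) k)"
proof (induction k)
  case 0
  then show ?case by (intro exI[of _ 1]) auto
next
  case (Suc k)
  then obtain q where q: "degree q \<le> k" "\<And>y. poly q y = pochhammer (u + v * y) k" by auto
  have "degree (q * [:u + of_nat k, v:]) \<le> k + 1"
    using q(1) by (intro order_trans[OF degree_mult_le] add_mono) auto
  then show ?case
    by (intro exI[of _ "q * [:u + of_nat k, v:]"]) (auto simp: q(2) pochhammer_Suc algebra_simps)
qed

text \<open>
  Both sides are \<open>\<Gamma>(x + a) \<Gamma>(x + b) / \<Gamma>(x)\<close>, but in this form the identity holds also where
  \<open>\<Gamma>(x)\<close> has a pole.  That case does occur below: \<open>p + j + 1\<close> may be a nonpositive integer.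
\<close>

lemma pochhammer_Gamma_exchange:
  fixes x :: real
  assumes "x + real a > 0" "x + real b > 0"
  shows "pochhammer x a * Gamma (x + real b) = pochhammer x b * Gamma (x + real a)"
proof -
  have *: "pochhammer x a * Gamma (x + real b) = pochhammer x b * Gamma (x + real a)"
    if "a \<le> b" "x + real a > 0" for a b
  proof -
    have "x + real a \<notin> \<int>\<^sub>\<le>\<^sub>0" using that(2) nonpos_Ints_nonpos by force
    then have "pochhammer (x + real a) (b - a) = Gamma (x + real a + real (b - a)) / Gamma (x + real a)"
      by (rule pochhammer_Gamma)
    also have "x + real a + real (b - a) = x + real b" using that by simp
    finally have "pochhammer (x + real a) (b - a) * Gamma (x + real a) = Gamma (x + real b)"
      using Gamma_real_pos[OF that(2)] by (simp add: field_simps)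
    then show ?thesis unfolding pochhammer_product[OF that(1), of x] by (metis mult.assoc)
  qed
  show ?thesis using *[of a b] *[of b a] assms by (cases "a \<le> b") auto
qed

text \<open>
  A single term of the moment: all factors except an alternating binomial coefficient and a
  rational function of \<open>j\<close> can be collected in front.
\<close>

lemma coeff_zernike_poly_Beta:
  fixes p N :: real
  assumes j: "j \<le> m" and k: "k \<le> m" and pk: "p + real k > - 1" and pm: "p + real m > - 1" and N: "N > 2 * real m"
  shows "coeff (zernike_poly (p + real m) (N - real m) m) j * Beta (p + real k + real j + 1) (N - real k - real j) =
     Gamma (p + real m + 1) * Gamma (N - real m + 1) / Gamma (p + N + 1) *
     ((- 1) ^ j * of_nat (m choose j) * (pochhammer (p + 1 + real j) k *
       (if k = m then 1 / (N - real m - real j) else pochhammer (N - real m - real j + 1) (m - k - 1))))"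
proof -
  have "pochhammer (p + 1 + real j) (m - j) * Gamma (p + 1 + real j + real k) =
      pochhammer (p + 1 + real j) k * Gamma (p + 1 + real j + real (m - j))"
    by (rule pochhammer_Gamma_exchange) (use assms in \<open>auto simp: of_nat_diff\<close>)
  then have 1: "pochhammer (p + 1 + real j) (m - j) * Gamma (p + real k + real j + 1) =
      pochhammer (p + 1 + real j) k * Gamma (p + real m + 1)"
    using j by (simp add: of_nat_diff add_ac)
  have xp: "N - real m - real j > 0" using N j by simp
  have 2: "pochhammer (N - real m - real j + 1) j * Gamma (N - real k - real j) = Gamma (N - real m + 1) *
    (if k = m then 1 / (N - real m - real j) else pochhammer (N - real m - real j + 1) (m - k - 1))"
  proof (cases "k = m")
    case False
    have "pochhammer (N - real m - real j + 1) j * Gamma (N - real m - real j + 1 + real (m - k - 1)) =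
      pochhammer (N - real m - real j + 1) (m - k - 1) * Gamma (N - real m - real j + 1 + real j)"
      by (rule pochhammer_Gamma_exchange) (use xp in auto)
    then show ?thesis using False k by (simp add: of_nat_diff algebra_simps)
  next
    case True
    have "pochhammer (N - real m - real j + 1) j * Gamma (N - real m - real j + 1 + real 0) =
      pochhammer (N - real m - real j + 1) 0 * Gamma (N - real m - real j + 1 + real j)"
      by (rule pochhammer_Gamma_exchange) (use xp in auto)
    then have "pochhammer (N - real m - real j + 1) j * Gamma (N - real m - real j + 1) = Gamma (N - real m + 1)"
      by (simp add: algebra_simps)
    moreover have "Gamma (N - real m - real j + 1) = (N - real m - real j) * Gamma (N - real m - real j)"
      by (rule Gamma_plus1) (use xp nonpos_Ints_nonpos in force)
    ultimately have "pochhammer (N - real m - real j + 1) j * Gamma (N - real m - real j) * (N - real m - real j) = Gamma (N - real m + 1)"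
      by (metis mult.assoc mult.commute)
    then show ?thesis using True xp by (simp add: eq_divide_eq)
  qed
  have fm: "fact m = of_nat (m choose j) * fact j * (fact (m - j) :: real)"
    by (simp add: binomial_fact[OF j])
  have b: "p + real m - real (m - j) + 1 = p + 1 + real j"
    using j by (simp add: of_nat_diff)
  have "coeff (zernike_poly (p + real m) (N - real m) m) j = (- 1) ^ j * of_nat (m choose j) * 
    (pochhammer (p + 1 + real j) (m - j) * pochhammer (N - real m - real j + 1) j)"
    using j unfolding coeff_zernike_poly gbinomial_pochhammer' b fm by simp
  then have "coeff (zernike_poly (p + real m) (N - real m) m) j * Beta (p + real k + real j + 1) (N - real k - real j) =
    (- 1) ^ j * of_nat (m choose j) * ((pochhammer (p + 1 + real j) (m - j) * Gamma (p + real k + real j + 1)) *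
       (pochhammer (N - real m - real j + 1) j * Gamma (N - real k - real j))) / Gamma (p + N + 1)"
    unfolding Beta_def by (simp add: algebra_simps)
  also have "\<dots> =  Gamma (p + real m + 1) * Gamma (N - real m + 1) / Gamma (p + N + 1) *
     ((- 1) ^ j * of_nat (m choose j) * (pochhammer (p + 1 + real j) k *
       (if k = m then 1 / (N - real m - real j) else pochhammer (N - real m - real j + 1) (m - k - 1))))"
    unfolding 1 2 by simp
  finally show ?thesis .
qed

text \<open>
  The summands are values at \<open>j\<close> of a polynomial of degree \<open>k + (m - k - 1) = m - 1\<close> if
  \<open>k < m\<close>; for \<open>k = m\<close> they are a polynomial of degree \<open>m\<close> divided by \<open>N - m - j\<close>.
\<close>

lemma zernike_poly_Beta_moment:
  fixes p N :: real
  assumes k: "k \<le> m" and pk: "p + real k > - 1" and pm: "p + real m > - 1" and N: "N > 2 * real m"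
  shows "(\<Sum>j\<le>m. coeff (zernike_poly (p + real m) (N - real m) m) j * Beta (p + real k + real j + 1) (N - real k - real j)) =
    (if k = m then (- 1) ^ m * fact m * Gamma (p + real m + 1) * Gamma (N - 2 * real m) / Gamma (p + N - real m + 1) else 0)"
proof -
  let ?C = "Gamma (p + real m + 1) * Gamma (N - real m + 1) / Gamma (p + N + 1)"
  have *: "(\<Sum>j\<le>m. coeff (zernike_poly (p + real m) (N - real m) m) j * Beta (p + real k + real j + 1) (N - real k - real j)) =
    ?C * (\<Sum>j\<le>m. (- 1) ^ j * of_nat (m choose j) * (pochhammer (p + 1 + real j) k *
       (if k = m then 1 / (N - real m - real j) else pochhammer (N - real m - real j + 1) (m - k - 1))))"
    unfolding sum_distrib_left by (rule sum.cong) (simp_all only: coeff_zernike_poly_Beta[OF _ assms] atMost_iff)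
  obtain q where q: "degree q \<le> k" "\<And>y. poly q y = pochhammer (p + 1 + y) k"
    using pochhammer_affine_poly[of k "p + 1" 1] by auto
  show ?thesis
  proof (cases "k = m")
    case True
    have P: "pochhammer (N - 2 * real m) (Suc m) * Gamma (N - 2 * real m) = Gamma (N - real m + 1)"
      using pochhammer_Gamma_exchange[of "N - 2 * real m" "Suc m" 0] N by (simp add: algebra_simps)
    have Q: "pochhammer (p + N - real m + 1) m * Gamma (p + N - real m + 1) = Gamma (p + N + 1)"
      using pochhammer_Gamma_exchange[of "p + N - real m + 1" m 0] N pm by (simp add: algebra_simps)
    have pos: "pochhammer (N - 2 * real m) (Suc m) > 0" "pochhammer (p + N - real m + 1) m > 0"
      using N pm by (auto intro!: pochhammer_pos)
    have "(\<Sum>j\<le>m. (- 1) ^ j * of_nat (m choose j) * (poly q (of_nat j) / ((N - real m) - of_nat j))) =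
     poly q (N - real m) * ((- 1) ^ m * fact m / pochhammer (N - real m - real m) (Suc m))"
      using q(1) True N by (intro alternating_sum_poly_divide) auto
    also have "N - real m - real m = N - 2 * real m" by simp
    also have "poly q (N - real m) = pochhammer (p + N - real m + 1) m"
      unfolding q(2) True by (simp add: algebra_simps)
    finally have "(\<Sum>j\<le>m. (- 1) ^ j * of_nat (m choose j) * (pochhammer (p + 1 + real j) k *
       (if k = m then 1 / (N - real m - real j) else pochhammer (N - real m - real j + 1) (m - k - 1)))) = 
       pochhammer (p + N - real m + 1) m * ((- 1) ^ m * fact m / pochhammer (N - 2 * real m) (Suc m))"
      using True by (simp add: q(2))
    then show ?thesis
      unfolding * P[symmetric] Q[symmetric] using pos True by simp
  next
    case False
    obtain r where r: "degree r \<le> m - k - 1" "\<And>y. poly r y = pochhammer (N - real m + 1 - y) (m - k - 1)"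
      using pochhammer_affine_poly[of "m - k - 1" "N - real m + 1" "- 1"] by auto
    have "degree (q * r) \<le> k + (m - k - 1)"
      using q(1) r(1) by (intro order_trans[OF degree_mult_le] add_mono)
    also have "\<dots> < m" using k False by simp
    finally have "(\<Sum>j\<le>m. (- 1) ^ j * of_nat (m choose j) * poly (q * r) (of_nat j)) = 0"
      by (rule alternating_sum_poly)
    then show ?thesis
      unfolding * using False by (simp add: q(2) r(2) algebra_simps)
  qed
qed

section \<open>Integrals over the disc\<close>

text \<open>
  A rotation maps a box to a set that is not a box, so its area has to come from the change
  of variables formula for linear maps of \<open>\<real>\<^sup>2\<close>; the identification with
  the complex plane maps boxes to boxes and hence preserves Lebesgue measure.
\<close>

lemma distr_lborel_rotation:
  assumes c: "cmod c = 1"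
  shows "distr lborel borel ((*) c) = (lborel :: complex measure)"
proof -
  define g :: "real^2 \<Rightarrow> complex" where "g v = Complex (v $ 1) (v $ 2)" for v
  define R :: "complex \<Rightarrow> real^2" where "R z = vector [Re z, Im z]" for z
  have gR: "g (R z) = z" "R (g v) = v" for z v
    by (auto simp: g_def R_def vec_eq_iff forall_2)
  have R_eq: "R = (\<lambda>z. Re z *\<^sub>R axis 1 1 + Im z *\<^sub>R axis 2 1)"
    by (auto simp: R_def vec_eq_iff forall_2 fun_eq_iff axis_def)
  have lg: "linear g" by (rule linearI) (auto simp: g_def complex_eq_iff)
  have lR: "linear R" unfolding R_eq by (rule linearI) (auto simp: algebra_simps)
  have [measurable]: "g \<in> borel_measurable borel" "R \<in> borel_measurable borel"
    using lg lR by (auto intro!: borel_measurable_continuous_onI linear_continuous_on simp: linear_conv_bounded_linear)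
  have vimage_box: "g -` box l u = box (R l) (R u)" for l u
    by (auto simp: g_def R_def in_box_complex_iff mem_box_cart forall_2)
  have lborel_g: "distr lborel borel g = lborel"
  proof (rule lborel_eqI[symmetric])
    fix l u :: complex assume le: "\<And>b. b \<in> Basis \<Longrightarrow> l \<bullet> b \<le> u \<bullet> b"
    have le2: "R l \<bullet> b \<le> R u \<bullet> b" if "b \<in> Basis" for b
      using le[of 1] le[of \<i>] that by (fastforce simp: Basis_vec_def R_def inner_axis Basis_complex_def UNIV_2)
    have "emeasure (distr lborel borel g) (box l u) = emeasure lborel (box (R l) (R u))"
      by (simp add: emeasure_distr vimage_box)
    also have "\<dots> = (\<Prod>b\<in>Basis. (R u - R l) \<bullet> b)"
      by (rule emeasure_lborel_box) (use le2 in auto)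
    also have "(\<Prod>b\<in>Basis. (R u - R l) \<bullet> b) = (\<Prod>b\<in>Basis. (u - l) \<bullet> b)"
    proof -
      have B: "(Basis :: (real^2) set) = {axis 1 1, axis 2 1}" "axis 1 1 \<noteq> (axis 2 1 :: real^2)"
        by (auto simp: Basis_vec_def UNIV_2 axis_eq_axis)
      have "(\<Prod>b\<in>Basis. (R u - R l) \<bullet> b) = ((R u - R l) \<bullet> axis 1 1) * ((R u - R l) \<bullet> axis 2 1)"
        unfolding B(1) using B(2) by simp
      then show ?thesis by (simp add: Basis_complex_def inner_axis R_def)
    qed
    finally show "emeasure (distr lborel borel g) (box l u) = (\<Prod>b\<in>Basis. (u - l) \<bullet> b)" .
  qed simp
  define T where "T d = R \<circ> ((*) d) \<circ> g" for d
  have lT: "linear (T d)" for d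
    unfolding T_def by (intro linear_compose lg lR) (auto intro!: linearI simp: algebra_simps)
  have detT: "det (matrix (T d)) = (cmod d)\<^sup>2" for d
    by (simp add: det_2 matrix_def T_def g_def R_def axis_def cmod_power2) (simp add: power2_eq_square)
  have cg: "((*) c \<circ> g) \<in> borel_measurable borel" unfolding comp_def by measurable
  have "distr lborel borel ((*) c \<circ> g) = lborel"
  proof (rule lborel_eqI[symmetric])
    fix l u :: complex assume le: "\<And>b. b \<in> Basis \<Longrightarrow> l \<bullet> b \<le> u \<bullet> b"
    have inv: "cnj c * c = 1" using c complex_norm_square[of c] by (simp add: mult.commute)
    let ?B = "box (R l) (R u)"
    have V: "((*) c \<circ> g) -` box l u = T (cnj c) ` ?B"
    proof (intro equalityI subsetI)
      fix v assume "v \<in> ((*) c \<circ> g) -` box l u"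
      then have "R (c * g v) \<in> ?B" unfolding vimage_box[symmetric] by (simp add: gR)
      moreover have "T (cnj c) (R (c * g v)) = v"
        by (simp add: T_def gR mult.assoc[symmetric] inv)
      ultimately show "v \<in> T (cnj c) ` ?B" by (metis imageI)
    next
      fix v assume "v \<in> T (cnj c) ` ?B"
      then obtain w where "v = T (cnj c) w" "g w \<in> box l u" unfolding vimage_box[symmetric] by auto
      moreover have "c * cnj c = 1" using inv by (simp add: mult.commute)
      ultimately show "v \<in> ((*) c \<circ> g) -` box l u"
        by (simp add: T_def gR mult.assoc[symmetric])
    qed
    then have "emeasure (distr lborel borel ((*) c \<circ> g)) (box l u) = emeasure lborel (T (cnj c) ` ?B)"
      by (simp add: emeasure_distr cg)
    also have "\<dots> = emeasure lborel ?B"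
    proof -
      have "T (cnj c) ` ?B \<in> sets lborel"
        unfolding V[symmetric] using measurable_sets_borel[OF cg] by simp
      moreover have "T (cnj c) ` ?B \<in> lmeasurable" "measure lebesgue (T (cnj c) ` ?B) = measure lebesgue ?B"
        using measurable_linear_image[OF lT, of ?B] measure_linear_image[OF lT, of ?B] 
        by (simp_all add: detT c)
      ultimately have "emeasure lebesgue (T (cnj c) ` ?B) = emeasure lebesgue ?B"
        using lmeasurable_box[of "R l" "R u"] by (simp only: emeasure_eq_measure2)
      then show ?thesis using \<open>T (cnj c) ` ?B \<in> sets lborel\<close> by simp
    qed
    also have "\<dots> = emeasure (distr lborel borel g) (box l u)"
      by (simp add: emeasure_distr vimage_box)
    also have "\<dots> = (\<Prod>b\<in>Basis. (u - l) \<bullet> b)"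
      unfolding lborel_g using le by (rule emeasure_lborel_box)
    finally show "emeasure (distr lborel borel ((*) c \<circ> g)) (box l u) = (\<Prod>b\<in>Basis. (u - l) \<bullet> b)" .
  qed simp
  also have "distr lborel borel ((*) c \<circ> g) = distr (distr lborel borel g) borel ((*) c)"
    by (simp add: distr_distr)
  finally show ?thesis unfolding lborel_g .
qed

lemma integral_lborel_rotation:
  fixes f :: "complex \<Rightarrow> complex"
  assumes "cmod c = 1" and [measurable]: "f \<in> borel_measurable borel"
  shows "(LINT z|lborel. f (c * z)) = (LINT z|lborel. f z)"
proof -
  have "(LINT z|lborel. f z) = (LINT z|distr lborel borel ((*) c). f z)"
    by (simp add: distr_lborel_rotation[OF assms(1)])
  also have "\<dots> = (LINT z|lborel. f (c * z))"
    by (rule integral_distr) auto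
  finally show ?thesis by simp
qed

text \<open>
  Rotating by the angle \<open>\<pi> / l\<close> multiplies the integrand by \<open>c\<^sup>l = - 1\<close>.  This also covers
  integrands that are not integrable.
\<close>

lemma integral_homogeneous_eq_0:
  fixes f :: "complex \<Rightarrow> complex"
  assumes [measurable]: "f \<in> borel_measurable borel" and l: "l \<noteq> 0"
    and f: "\<And>c z. cmod c = 1 \<Longrightarrow> f (c * z) = c powi l * f z"
  shows "(LINT z|lborel. f z) = 0"
proof -
  define c where "c = cis (pi / of_int l)"
  have c: "cmod c = 1" by (simp add: c_def)
  have "c powi l = - 1"
    using l by (simp add: c_def cis_power_int)
  then have "(LINT z|lborel. f z) = - (LINT z|lborel. f z)"
    using integral_lborel_rotation[OF c assms(1)] by (simp add: f[OF c])
  then show ?thesis by (simp add: complex_eq_iff)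
qed

text \<open>
  The substitute for polar coordinates: the part of the disc with \<open>\<bar>z\<bar>\<^sup>2 > x\<close> is an annulus of
  area \<open>\<pi> (1 - x)\<close> if \<open>0 \<le> x \<le> 1\<close>.
\<close>

lemma distr_squared_modulus_disc:
  "distr (density lborel (indicator unit_disc)) borel (\<lambda>z. (cmod z)\<^sup>2) =
   density lborel (\<lambda>t. ennreal pi * indicator {0..1} t)"
proof (rule measure_eqI_lessThan)
  fix x :: real
  \<comment> \<open>The measures are compared on all half-lines; \<open>y\<close> truncates \<open>x\<close> to the unit interval.\<close>
  define y where "y = min 1 (max 0 x)"
  have y: "0 \<le> y" "y \<le> 1" by (auto simp: y_def)
  have "emeasure (distr (density lborel (indicator unit_disc)) borel (\<lambda>z. (cmod z)\<^sup>2)) {x<..} =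
     emeasure lborel (unit_disc \<inter> {z. x < (cmod z)\<^sup>2})"
    by (simp add: emeasure_distr emeasure_restricted vimage_def greaterThan_def)
  also have "\<dots> = ennreal (pi * (1 - y))"
  proof (cases "x < 0")
    case True
    then have "unit_disc \<inter> {z. x < (cmod z)\<^sup>2} = unit_disc"
      using less_le_trans[OF _ zero_le_power2] by blast
    then show ?thesis using True by (simp add: emeasure_ball unit_ball_vol_numeral y_def)
  next
    case False
    have "unit_disc \<inter> {z. x < (cmod z)\<^sup>2} = unit_disc - cball 0 (sqrt y)"
    proof -
      have "x < (cmod z)\<^sup>2 \<longleftrightarrow> \<not> cmod z \<le> sqrt y" if "cmod z < 1" for z
      proof -
        have 1: "(cmod z)\<^sup>2 < 1" using that by (simp add: abs_square_less_1)
        have "cmod z \<le> sqrt y \<longleftrightarrow> (cmod z)\<^sup>2 \<le> y"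
          using y real_sqrt_le_iff[of "(cmod z)\<^sup>2" y] by simp
        then show ?thesis using False 1 by (auto simp: y_def)
      qed
      then show ?thesis by auto
    qed
    moreover have "emeasure lborel (unit_disc - cball 0 (sqrt y)) = ennreal (pi * (1 - y))"
    proof (cases "y = 1")
      case True
      then show ?thesis by (simp add: emeasure_eq_0_AE Diff_eq_empty_iff[THEN iffD2, OF ball_subset_cball])
    next
      case False
      then have "sqrt y < 1" using y by simp
      then have "cball 0 (sqrt y) \<subseteq> unit_disc" by (simp add: cball_subset_ball_iff)
      then have "emeasure lborel (unit_disc - cball 0 (sqrt y)) = emeasure lborel unit_disc - emeasure lborel (cball 0 (sqrt y) :: complex set)"
        by (intro emeasure_Diff) (auto simp: emeasure_cball y)
      then show ?thesis
        using y by (simp add: emeasure_ball emeasure_cball unit_ball_vol_numeral ennreal_minus algebra_simps)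
    qed
    ultimately show ?thesis by simp
  qed
  also have "\<dots> = emeasure (density lborel (\<lambda>t. ennreal pi * indicator {0..1} t)) {x<..}"
  proof -
    have "emeasure (density lborel (\<lambda>t. ennreal pi * indicator {0..1} t)) {x<..} =
       ennreal pi * emeasure lborel ({0..1} \<inter> {x<..})"
      by (simp add: emeasure_density mult.assoc nn_integral_cmult flip: indicator_inter_arith[where 'a=ennreal])
    also have "emeasure lborel ({0..1} \<inter> {x<..}) = ennreal (1 - y)"
    proof (cases "x < 0")
      case True
      then have "{0..1} \<inter> {x<..} = {0..1}" by auto
      then show ?thesis using True by (simp add: y_def)
    next
      case False
      then have "{0..1} \<inter> {x<..} = {x<..1}" by auto
      then show ?thesis using False by (cases "x \<le> 1") (auto simp: y_def)
    qed
    finally show ?thesis using y by (simp add: ennreal_mult)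
  qed
  finally show *: "emeasure (distr (density lborel (indicator unit_disc)) borel (\<lambda>z. (cmod z)\<^sup>2)) {x<..} =
     emeasure (density lborel (\<lambda>t. ennreal pi * indicator {0..1} t)) {x<..}" .
  show "emeasure (distr (density lborel (indicator unit_disc)) borel (\<lambda>z. (cmod z)\<^sup>2)) {x<..} < \<infinity>"
  proof -
    have "emeasure (distr (density lborel (indicator unit_disc)) borel (\<lambda>z. (cmod z)\<^sup>2)) {x<..} \<le> emeasure lborel unit_disc"
      by (simp add: emeasure_distr emeasure_restricted vimage_def greaterThan_def) (auto intro!: emeasure_mono)
    also have "\<dots> < \<infinity>" by (simp add: emeasure_ball)
    finally show ?thesis .
  qed
qed simp_all

lemma has_bochner_integral_disc_radial:
  fixes f :: "real \<Rightarrow> real"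
  assumes [measurable]: "f \<in> borel_measurable borel"
    and f: "has_bochner_integral lborel (\<lambda>t. indicator {0..1} t * f t) I"
  shows "has_bochner_integral lborel (\<lambda>z. indicator unit_disc z * f ((cmod z)\<^sup>2)) (pi * I)"
proof -
  have "has_bochner_integral (density lborel (\<lambda>t. ennreal pi * indicator {0..1} t)) f (pi * I)"
  proof -
    have e: "(\<lambda>t. ennreal pi * indicator {0..1} t) = (\<lambda>t::real. ennreal (pi * indicator {0..1} t))"
      by (auto simp: fun_eq_iff indicator_def)
    show ?thesis unfolding e
      using has_bochner_integral_mult_right[OF f, of pi]
      by (subst has_bochner_integral_density) (auto simp: mult.assoc)
  qed
  then have "has_bochner_integral (density lborel (indicator unit_disc)) (\<lambda>z. f ((cmod z)\<^sup>2)) (pi * I)"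
    unfolding distr_squared_modulus_disc[symmetric]
    by (simp add: has_bochner_integral_iff integrable_distr_eq integral_distr)
  then have D: "has_bochner_integral (density lborel (\<lambda>z. ennreal (indicator unit_disc z))) (\<lambda>z. f ((cmod z)\<^sup>2)) (pi * I)"
    by (simp add: ennreal_indicator)
  have [measurable]: "(\<lambda>z::complex. f ((cmod z)\<^sup>2)) \<in> borel_measurable lborel"
    using measurable_compose[of "\<lambda>z::complex. (cmod z)\<^sup>2" lborel borel f borel] by measurable
  have i: "integrable (density lborel (\<lambda>z. ennreal (indicator unit_disc z))) (\<lambda>z. f ((cmod z)\<^sup>2)) \<longleftrightarrow>
      integrable lborel (\<lambda>z. indicator unit_disc z *\<^sub>R f ((cmod z)\<^sup>2))"
    by (rule integrable_density) (auto intro!: borel_measurable_indicator)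
  have j: "(LINT z|density lborel (\<lambda>z. ennreal (indicator unit_disc z)). f ((cmod z)\<^sup>2)) =
      (LINT z|lborel. indicator unit_disc z *\<^sub>R f ((cmod z)\<^sup>2))"
    by (rule integral_density) (auto intro!: borel_measurable_indicator)
  show ?thesis
    using D unfolding has_bochner_integral_iff i j by simp
qed

section \<open>Inner products\<close>

text \<open>
  This is where the integrality condition enters.  If \<open>p\<close> is a negative integer, then
  \<open>p + m\<close> is a natural number and \<open>(p + m gchoose (m - k))\<close> vanishes for \<open>k < - p\<close>; precisely
  the powers of \<open>t\<close> that are not integrable at \<open>0\<close> drop out of the polynomial.
\<close>

lemma zernike_poly_coeff_nonzero:
  fixes p :: real
  assumes "p + real m > - 1" and "p \<in> \<int> \<or> p > - 1" and "coeff (zernike_poly (p + real m) c m) k \<noteq> 0"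
  shows "p + real k > - 1"
proof (cases "p > - 1")
  case False
  then obtain i where i: "p = of_int i" using assms(2) by (auto elim: Ints_cases)
  define d where "d = nat (i + int m)"
  have d: "p + real m = of_nat d"
    using assms(1) unfolding d_def i by simp
  have "k \<le> m" "(p + real m gchoose (m - k)) \<noteq> 0" using assms(3) by (auto simp: coeff_zernike_poly split: if_splits)
  then have "m - k \<le> d" 
    unfolding d binomial_gbinomial[symmetric] by (auto simp: binomial_eq_0_iff)
  then show ?thesis using d \<open>k \<le> m\<close> by linarith
qed auto

lemma degree_zernike_poly: "degree (zernike_poly b c m) \<le> m"
  by (rule degree_le) (simp add: coeff_zernike_poly)

lemma zernike_poly_nonzero:
  assumes "c > real m - 1"
  shows "zernike_poly b c m \<noteq> 0"
proof -
  have "pochhammer (c - real m + 1) m > 0" using assms by (intro pochhammer_pos) auto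
  then have "coeff (zernike_poly b c m) m \<noteq> 0"
    unfolding coeff_zernike_poly gbinomial_pochhammer' by simp
  then show ?thesis by auto
qed

lemma has_bochner_integral_Beta:
  assumes "a > 0" "b > (0::real)"
  shows "has_bochner_integral lborel (\<lambda>t. indicator {0..1} t * (t powr (a - 1) * (1 - t) powr (b - 1))) (Beta a b)"
proof -
  note I = integrable_Beta[OF assms]
  have "(LINT t:{0..1}|lborel. t powr (a - 1) * (1 - t) powr (b - 1)) = Beta a b"
    using set_borel_integral_eq_integral(2)[OF I] has_integral_Beta_real[OF assms] by (simp add: integral_unique)
  then show ?thesis using I
    by (simp add: has_bochner_integral_iff set_integrable_def set_lebesgue_integral_def)
qed

lemma poly_eq_sum_le: "degree P \<le> m \<Longrightarrow> poly P x = (\<Sum>i\<le>m. coeff P i * x ^ i)" for P :: "real poly"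
  unfolding poly_altdef by (rule sum.mono_neutral_left) (auto simp: coeff_eq_0)

text \<open>
  Coefficients that vanish are allowed to belong to divergent Beta integrals; this is needed if
  \<open>p \<le> - 1\<close>.
\<close>

lemma has_bochner_integral_poly_Beta:
  fixes P Q :: "real poly" and p N :: real
  assumes dP: "degree P \<le> m" and dQ: "degree Q \<le> m'" and N: "real m + real m' < N"
    and P: "\<And>j. coeff P j \<noteq> 0 \<Longrightarrow> p + real j > - 1" and Q: "\<And>k. coeff Q k \<noteq> 0 \<Longrightarrow> p + real k > - 1"
  shows "has_bochner_integral lborel 
     (\<lambda>t. indicator {0..1} t * (t powr p * (1 - t) powr (N - 1) * poly P (t / (1 - t)) * poly Q (t / (1 - t))))
     (\<Sum>k\<le>m'. coeff Q k * (\<Sum>j\<le>m. coeff P j * Beta (p + real k + real j + 1) (N - real k - real j)))"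
proof -
  have pw: "indicator {0..1} t * (t powr p * (1 - t) powr (N - 1) * poly P (t / (1 - t)) * poly Q (t / (1 - t))) =
    (\<Sum>k\<le>m'. \<Sum>j\<le>m. coeff Q k * coeff P j * (indicator {0..1} t * (t powr (p + real k + real j + 1 - 1) * (1 - t) powr (N - real k - real j - 1))))" for t
  proof (cases "0 < t \<and> t < 1")
    case True
    have "t powr p * (1 - t) powr (N - 1) * ((t / (1 - t)) ^ j * (t / (1 - t)) ^ k) = t powr (p + real k + real j + 1 - 1) * (1 - t) powr (N - real k - real j - 1)" for j k
    proof -
      have "t powr (p + real k + real j + 1 - 1) = t powr p * t ^ k * t ^ j"
        using True by (simp add: powr_add powr_realpow)
      moreover have "(1 - t) powr (N - real k - real j - 1) = (1 - t) powr (N - 1) / ((1 - t) ^ k * (1 - t) ^ j)"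
      proof -
        have "N - real k - real j - 1 = (N - 1) - real k - real j" by simp
        then show ?thesis using True by (simp only: powr_diff) (simp add: powr_realpow)
      qed
      ultimately show ?thesis by (simp add: power_divide mult_ac)
    qed
    note e = this
    have "t powr p * (1 - t) powr (N - 1) * poly P (t / (1 - t)) * poly Q (t / (1 - t)) =
       t powr p * (1 - t) powr (N - 1) * (poly Q (t / (1 - t)) * poly P (t / (1 - t)))"
      by (simp only: mult_ac)
    also have "\<dots> = (\<Sum>k\<le>m'. \<Sum>j\<le>m. t powr p * (1 - t) powr (N - 1) * (coeff Q k * (t / (1 - t)) ^ k * (coeff P j * (t / (1 - t)) ^ j)))"
      unfolding poly_eq_sum_le[OF dP] poly_eq_sum_le[OF dQ] sum_product by (simp only: sum_distrib_left)
    also have "\<dots> = (\<Sum>k\<le>m'. \<Sum>j\<le>m. coeff Q k * coeff P j * (t powr (p + real k + real j + 1 - 1) * (1 - t) powr (N - real k - real j - 1)))"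
      unfolding e[symmetric] by (simp only: mult_ac)
    finally show ?thesis using True by simp
  qed (auto simp: indicator_def not_less)
  have "has_bochner_integral lborel (\<lambda>t. \<Sum>k\<le>m'. \<Sum>j\<le>m. coeff Q k * coeff P j * (indicator {0..1} t * (t powr (p + real k + real j + 1 - 1) * (1 - t) powr (N - real k - real j - 1))))
    (\<Sum>k\<le>m'. \<Sum>j\<le>m. coeff Q k * coeff P j * Beta (p + real k + real j + 1) (N - real k - real j))"
  proof (intro has_bochner_integral_sum)
    fix k j assume "k \<in> {..m'}" "j \<in> {..m}"
    then have kj: "real k \<le> real m'" "real j \<le> real m" by auto
    show "has_bochner_integral lborel (\<lambda>t. coeff Q k * coeff P j * (indicator {0..1} t * (t powr (p + real k + real j + 1 - 1) * (1 - t) powr (N - real k - real j - 1))))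
      (coeff Q k * coeff P j * Beta (p + real k + real j + 1) (N - real k - real j))"
    proof (cases "coeff Q k = 0 \<or> coeff P j = 0")
      case True
      then show ?thesis by (auto simp: has_bochner_integral_zero)
    next
      case False
      then show ?thesis
        using Q[of k] kj N by (intro has_bochner_integral_mult_right has_bochner_integral_Beta) auto
    qed
  qed
  then show ?thesis unfolding pw by (simp add: sum_distrib_left mult.assoc)
qed

text \<open>
  For \<open>m' \<le> m\<close> the polynomial of degree \<open>m'\<close> meets at most one moment that does not vanish,
  the one against \<open>x\<^sup>m\<close>; it is reached only if \<open>m' = m\<close>, and then by the leading coefficient.
\<close>

lemma has_bochner_integral_zernike_poly:
  fixes p N :: real
  assumes "p + real m > - 1" "p + real m' > - 1" "p \<in> \<int> \<or> p > - 1" "N > 2 * real m" "N > 2 * real m'" "m' \<le> m"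
  shows "has_bochner_integral lborel 
     (\<lambda>t. indicator {0..1} t * (t powr p * (1 - t) powr (N - 1) * poly (zernike_poly (p + real m) (N - real m) m) (t / (1 - t)) *
         poly (zernike_poly (p + real m') (N - real m') m') (t / (1 - t))))
     (if m = m' then fact m * Gamma (N - real m + 1) * Gamma (p + real m + 1) / ((N - 2 * real m) * Gamma (p + N - real m + 1)) else 0)"
proof -
  let ?P = "zernike_poly (p + real m) (N - real m) m" and ?Q = "zernike_poly (p + real m') (N - real m') m'"
  let ?M = "(- 1) ^ m * fact m * Gamma (p + real m + 1) * Gamma (N - 2 * real m) / Gamma (p + N - real m + 1)"
  have "coeff ?Q k * (\<Sum>j\<le>m. coeff ?P j * Beta (p + real k + real j + 1) (N - real k - real j)) = (if k = m then coeff ?Q m * ?M else 0)"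
    if "k \<le> m'" for k
  proof (cases "coeff ?Q k = 0")
    case False
    then have "p + real k > - 1" using zernike_poly_coeff_nonzero[OF assms(2,3)] by blast
    then show ?thesis
      using zernike_poly_Beta_moment[of k m p N] assms that by simp
  qed auto
  then have J: "(\<Sum>k\<le>m'. coeff ?Q k * (\<Sum>j\<le>m. coeff ?P j * Beta (p + real k + real j + 1) (N - real k - real j))) = (if m = m' then coeff ?P m * ?M else 0)"
    using assms(6) by (simp add: sum.delta)
  have "coeff ?P m * ?M = fact m * Gamma (N - real m + 1) * Gamma (p + real m + 1) / ((N - 2 * real m) * Gamma (p + N - real m + 1))"
  proof -
    have "pochhammer (N - 2 * real m + 1) m * Gamma (N - 2 * real m + 1) = Gamma (N - real m + 1)"
      using pochhammer_Gamma_exchange[of "N - 2 * real m + 1" m 0] assms(4) by (simp add: algebra_simps)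
    moreover have "Gamma (N - 2 * real m + 1) = (N - 2 * real m) * Gamma (N - 2 * real m)"
      by (rule Gamma_plus1) (use assms(4) nonpos_Ints_nonpos in force)
    ultimately have G: "pochhammer (N - 2 * real m + 1) m * Gamma (N - 2 * real m) = Gamma (N - real m + 1) / (N - 2 * real m)"
      using assms(4) by (simp add: eq_divide_eq mult_ac)
    have "N - real m - real m + 1 = N - 2 * real m + 1" by simp
    then have "coeff ?P m = (- 1) ^ m * pochhammer (N - 2 * real m + 1) m"
      unfolding coeff_zernike_poly gbinomial_pochhammer' by simp
    then have "coeff ?P m * ?M = fact m * Gamma (p + real m + 1) * (pochhammer (N - 2 * real m + 1) m * Gamma (N - 2 * real m)) / Gamma (p + N - real m + 1)"
      by (simp add: power_mult_distrib[symmetric] mult_ac flip: power_add)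
    then show ?thesis unfolding G by (simp add: mult_ac)
  qed
  note J = J[unfolded this]
  show ?thesis unfolding J[symmetric]
    using assms zernike_poly_coeff_nonzero[OF assms(1,3)] zernike_poly_coeff_nonzero[OF assms(2,3)]
    by (intro has_bochner_integral_poly_Beta degree_zernike_poly) auto
qed

lemma borel_measurable_h [measurable]: "h a b \<in> borel_measurable borel"
  unfolding h_def[abs_def] by measurable

lemma borel_measurable_polar_fun [measurable]: "polar_fun l a b P \<in> borel_measurable borel"
proof -
  have [measurable]: "poly P \<in> borel_measurable borel"
    by (intro borel_measurable_continuous_onI continuous_intros)
  have [measurable]: "(\<lambda>z::complex. z powi l) \<in> borel_measurable borel"
    unfolding power_int_def by measurable
  show ?thesis unfolding polar_fun_def[abs_def] by measurable
qed

lemma borel_measurable_polar_fun_mult_cnj [measurable]: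
  "(\<lambda>z. polar_fun l a b P z * cnj (polar_fun l' a' b' Q z)) \<in> borel_measurable borel"
proof -
  have [measurable]: "cnj \<in> borel_measurable borel"
    by (intro borel_measurable_continuous_onI continuous_intros)
  show ?thesis by measurable
qed

text \<open>
  Functions are known explicitly only away from the origin, which is a null set.
\<close>

lemma
  fixes f G :: "complex \<Rightarrow> 'b::{banach, second_countable_topology}"
  assumes G: "G \<in> borel_measurable borel" and fG: "\<And>z. z \<in> punctured_disc \<Longrightarrow> f z = G z"
  shows borel_measurable_mu: "f \<in> borel_measurable (mu \<alpha> \<beta>)"
    and integrable_mu: "integrable (mu \<alpha> \<beta>) f \<longleftrightarrow> integrable lborel (\<lambda>z. indicator unit_disc z *\<^sub>R (h \<alpha> \<beta> z *\<^sub>R G z))"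
    and integral_mu: "(LINT z|mu \<alpha> \<beta>. f z) = (LINT z|lborel. indicator unit_disc z *\<^sub>R (h \<alpha> \<beta> z *\<^sub>R G z))"
proof -
  note [measurable] = G
  have h0: "h \<alpha> \<beta> z \<ge> 0" for z by (simp add: h_def)
  have id: "indicator unit_disc \<in> borel_measurable (borel :: complex measure)" by (rule borel_measurable_indicator) auto
  have hm: "h \<alpha> \<beta> \<in> borel_measurable (lebesgue_on unit_disc)"
    by (intro measurable_restrict_space1 measurable_completion) simp
  have "(\<lambda>z. if z = 0 then f 0 else G z) \<in> borel_measurable (lebesgue_on unit_disc)"
    by (intro measurable_restrict_space1 measurable_completion) simp
  moreover have "f \<in> borel_measurable (lebesgue_on unit_disc) \<longleftrightarrow>
      (\<lambda>z. if z = 0 then f 0 else G z) \<in> borel_measurable (lebesgue_on unit_disc)"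
    by (rule measurable_cong) (use fG in auto)
  ultimately have fm: "f \<in> borel_measurable (lebesgue_on unit_disc)" by blast
  then show "f \<in> borel_measurable (mu \<alpha> \<beta>)" by (simp add: mu_def)
  have ae: "AE z in lebesgue. indicator unit_disc z *\<^sub>R (h \<alpha> \<beta> z *\<^sub>R f z) = indicator unit_disc z *\<^sub>R (h \<alpha> \<beta> z *\<^sub>R G z)"
  proof -
    have "AE z in lebesgue. z \<noteq> (0::complex)"
      by (intro AE_completion AE_lborel_singleton)
    then show ?thesis by eventually_elim (auto simp: indicator_def fG)
  qed
  have gm: "(\<lambda>z. indicator unit_disc z *\<^sub>R (h \<alpha> \<beta> z *\<^sub>R G z)) \<in> borel_measurable borel"
    using id by measurable
  have gm': "(\<lambda>z. indicator unit_disc z *\<^sub>R (h \<alpha> \<beta> z *\<^sub>R G z)) \<in> borel_measurable lebesgue"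
    using gm by (intro measurable_completion) simp
  have fm': "(\<lambda>z. indicator unit_disc z *\<^sub>R (h \<alpha> \<beta> z *\<^sub>R f z)) \<in> borel_measurable lebesgue"
    using fm hm by (subst borel_measurable_restrict_space_iff[symmetric]) auto
  have "integrable (mu \<alpha> \<beta>) f \<longleftrightarrow> integrable (lebesgue_on unit_disc) (\<lambda>z. h \<alpha> \<beta> z *\<^sub>R f z)"
    unfolding mu_def by (rule integrable_density[OF fm hm]) (simp add: h0)
  also have "\<dots> \<longleftrightarrow> integrable lebesgue (\<lambda>z. indicator unit_disc z *\<^sub>R (h \<alpha> \<beta> z *\<^sub>R f z))"
    by (rule integrable_restrict_space) simp
  also have "\<dots> \<longleftrightarrow> integrable lebesgue (\<lambda>z. indicator unit_disc z *\<^sub>R (h \<alpha> \<beta> z *\<^sub>R G z))"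
    by (rule integrable_cong_AE[OF fm' gm' ae])
  also have "\<dots> \<longleftrightarrow> integrable lborel (\<lambda>z. indicator unit_disc z *\<^sub>R (h \<alpha> \<beta> z *\<^sub>R G z))"
    by (rule integrable_completion) (use gm in simp)
  finally show "integrable (mu \<alpha> \<beta>) f \<longleftrightarrow> integrable lborel (\<lambda>z. indicator unit_disc z *\<^sub>R (h \<alpha> \<beta> z *\<^sub>R G z))" .
  have "(LINT z|mu \<alpha> \<beta>. f z) = (LINT z|lebesgue_on unit_disc. h \<alpha> \<beta> z *\<^sub>R f z)"
    unfolding mu_def by (rule integral_density[OF fm hm]) (simp add: h0)
  also have "\<dots> = (LINT z|lebesgue. indicator unit_disc z *\<^sub>R (h \<alpha> \<beta> z *\<^sub>R f z))"
    by (rule integral_restrict_space) simp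
  also have "\<dots> = (LINT z|lebesgue. indicator unit_disc z *\<^sub>R (h \<alpha> \<beta> z *\<^sub>R G z))"
    by (rule integral_cong_AE[OF fm' gm' ae])
  also have "\<dots> = (LINT z|lborel. indicator unit_disc z *\<^sub>R (h \<alpha> \<beta> z *\<^sub>R G z))"
    by (rule integral_completion) (use gm in simp)
  finally show "(LINT z|mu \<alpha> \<beta>. f z) = (LINT z|lborel. indicator unit_disc z *\<^sub>R (h \<alpha> \<beta> z *\<^sub>R G z))" .
qed

lemma polar_fun_rotate: "cmod c = 1 \<Longrightarrow> polar_fun l a b P (c * z) = c powi l * polar_fun l a b P z"
  by (simp add: polar_fun_def h_def norm_mult power_int_mult_distrib)

lemma L2_inner_polar_fun_0:
  assumes f: "\<And>z. z \<in> punctured_disc \<Longrightarrow> f z = polar_fun l a b P z"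
    and g: "\<And>z. z \<in> punctured_disc \<Longrightarrow> g z = polar_fun l' a' b' Q z" and "l \<noteq> l'"
  shows "L2_inner \<alpha> \<beta> f g = 0"
proof -
  have "L2_inner \<alpha> \<beta> f g = (LINT z|lborel. indicator unit_disc z *\<^sub>R (h \<alpha> \<beta> z *\<^sub>R (polar_fun l a b P z * cnj (polar_fun l' a' b' Q z))))"
    unfolding L2_inner_def using f g by (intro integral_mu borel_measurable_polar_fun_mult_cnj) auto
  also have "\<dots> = 0"
  proof (rule integral_homogeneous_eq_0)
    have "indicator unit_disc \<in> borel_measurable (borel :: complex measure)" by (rule borel_measurable_indicator) auto
    then show "(\<lambda>z. indicator unit_disc z *\<^sub>R (h \<alpha> \<beta> z *\<^sub>R (polar_fun l a b P z * cnj (polar_fun l' a' b' Q z)))) \<in> borel_measurable borel"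
      by measurable
    show "l - l' \<noteq> 0" using assms(3) by simp
    fix c z :: complex assume c: "cmod c = 1"
    then have c0: "c \<noteq> 0" by auto
    have "cnj c = inverse c" using c complex_norm_square[of c] c0 by (simp add: field_simps)
    then have "cnj (c powi l') = inverse (c powi l')"
      by (simp only: complex_cnj_power_int power_int_inverse)
    then have cc: "c powi l * cnj (c powi l') = c powi (l - l')"
      using power_int_diff[of c l l'] c0 by (simp add: divide_inverse)
    have "polar_fun l a b P (c * z) * cnj (polar_fun l' a' b' Q (c * z)) =
        (c powi l * cnj (c powi l')) * (polar_fun l a b P z * cnj (polar_fun l' a' b' Q z))"
      unfolding polar_fun_rotate[OF c] complex_cnj_mult by (simp only: mult_ac)
    then have "polar_fun l a b P (c * z) * cnj (polar_fun l' a' b' Q (c * z)) = c powi (l - l') * (polar_fun l a b P z * cnj (polar_fun l' a' b' Q z))"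
      unfolding cc .
    moreover have "indicator unit_disc (c * z) = (indicator unit_disc z :: real)" "h \<alpha> \<beta> (c * z) = h \<alpha> \<beta> z"
      using c by (auto simp: indicator_def h_def norm_mult)
    ultimately show "indicator unit_disc (c * z) *\<^sub>R (h \<alpha> \<beta> (c * z) *\<^sub>R (polar_fun l a b P (c * z) * cnj (polar_fun l' a' b' Q (c * z)))) =
      c powi (l - l') * (indicator unit_disc z *\<^sub>R (h \<alpha> \<beta> z *\<^sub>R (polar_fun l a b P z * cnj (polar_fun l' a' b' Q z))))"
      by (simp only: mult_scaleR_right)
  qed
  finally show ?thesis .
qed

lemma polar_fun_mult_cnj:
  assumes "z \<in> unit_disc"
  shows "h \<alpha> \<beta> z *\<^sub>R (polar_fun l a b P z * cnj (polar_fun l a b Q z)) = of_real ((\<lambda>t. t powr (of_int l + \<beta> + 2 * b) * (1 - t) powr (\<alpha> + 2 * a)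
     * poly P (t / (1 - t)) * poly Q (t / (1 - t))) ((cmod z)\<^sup>2))"
proof (cases "z = 0")
  case False
  define t where "t = (cmod z)\<^sup>2"
  have t: "0 < t" "t < 1" using punctured_disc_squared_modulus[of z] False assms by (auto simp: t_def)
  have "z powi l * cnj (z powi l) = (z * cnj z) powi l"
    by (simp add: power_int_mult_distrib)
  also have "\<dots> = of_real (t powi l)" unfolding t_def complex_norm_square[symmetric] by simp
  also have "t powi l = t powr (of_int l)" using t by (simp add: powr_real_of_int')
  finally have 1: "z powi l * cnj (z powi l) = of_real (t powr (of_int l))" .
  have "h \<alpha> \<beta> z *\<^sub>R (polar_fun l a b P z * cnj (polar_fun l a b Q z)) = (z powi l * cnj (z powi l)) *
     of_real ((1 - t) powr \<alpha> * t powr \<beta> * ((1 - t) powr a * t powr b)\<^sup>2 * poly P (t / (1 - t)) * poly Q (t / (1 - t)))"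
    unfolding polar_fun_def h_squared_modulus t_def[symmetric] by (simp add: scaleR_conv_of_real power2_eq_square mult_ac)
  also have "\<dots> = of_real (t powr (of_int l) * ((1 - t) powr \<alpha> * t powr \<beta> * ((1 - t) powr a * t powr b)\<^sup>2 * poly P (t / (1 - t)) * poly Q (t / (1 - t))))"
    unfolding 1 of_real_mult ..
  also have "t powr (of_int l) * ((1 - t) powr \<alpha> * t powr \<beta> * ((1 - t) powr a * t powr b)\<^sup>2 * poly P (t / (1 - t)) * poly Q (t / (1 - t))) =
     t powr (of_int l + \<beta> + 2 * b) * (1 - t) powr (\<alpha> + 2 * a) * poly P (t / (1 - t)) * poly Q (t / (1 - t))"
  proof -
    have "x powr (2 * y) = (x powr y)\<^sup>2" for x y :: real by (simp add: power2_eq_square flip: powr_add)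
    then show ?thesis by (simp add: powr_add power_mult_distrib mult_ac)
  qed
  finally show ?thesis unfolding t_def .
qed (simp add: polar_fun_def h_def)

lemma has_bochner_integral_mu_polar_fun:
  assumes f: "\<And>z. z \<in> punctured_disc \<Longrightarrow> f z = polar_fun l a b P z"
    and g: "\<And>z. z \<in> punctured_disc \<Longrightarrow> g z = polar_fun l a b Q z"
    and I: "has_bochner_integral lborel (\<lambda>t. indicator {0..1} t * (t powr (of_int l + \<beta> + 2 * b) * (1 - t) powr (\<alpha> + 2 * a)
     * poly P (t / (1 - t)) * poly Q (t / (1 - t)))) I"
  shows "has_bochner_integral (mu \<alpha> \<beta>) (\<lambda>z. f z * cnj (g z)) (of_real (pi * I))"
proof -
  let ?w = "\<lambda>t. t powr (of_int l + \<beta> + 2 * b) * (1 - t) powr (\<alpha> + 2 * a) * poly P (t / (1 - t)) * poly Q (t / (1 - t))"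
  have [measurable]: "poly R \<in> borel_measurable borel" for R :: "real poly"
    by (intro borel_measurable_continuous_onI continuous_intros)
  have "?w \<in> borel_measurable borel" by measurable
  from has_bochner_integral_of_real[OF has_bochner_integral_disc_radial[OF this I]]
  have "has_bochner_integral lborel (\<lambda>z. complex_of_real (indicator unit_disc z * ?w ((cmod z)\<^sup>2))) (of_real (pi * I))" .
  moreover have "complex_of_real (indicator unit_disc z * ?w ((cmod z)\<^sup>2)) = indicator unit_disc z *\<^sub>R (h \<alpha> \<beta> z *\<^sub>R (polar_fun l a b P z * cnj (polar_fun l a b Q z)))" for z
    using polar_fun_mult_cnj[of z \<alpha> \<beta> l a b P Q] by (cases "z \<in> unit_disc") auto
  ultimately have "has_bochner_integral lborel (\<lambda>z. indicator unit_disc z *\<^sub>R (h \<alpha> \<beta> z *\<^sub>R (polar_fun l a b P z * cnj (polar_fun l a b Q z)))) (of_real (pi * I))"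
    by simp
  moreover have "integrable (mu \<alpha> \<beta>) (\<lambda>z. f z * cnj (g z)) \<longleftrightarrow>
      integrable lborel (\<lambda>z. indicator unit_disc z *\<^sub>R (h \<alpha> \<beta> z *\<^sub>R (polar_fun l a b P z * cnj (polar_fun l a b Q z))))"
    by (rule integrable_mu[OF borel_measurable_polar_fun_mult_cnj]) (simp only: f g)
  moreover have "(LINT z|mu \<alpha> \<beta>. f z * cnj (g z)) =
      (LINT z|lborel. indicator unit_disc z *\<^sub>R (h \<alpha> \<beta> z *\<^sub>R (polar_fun l a b P z * cnj (polar_fun l a b Q z))))"
    by (rule integral_mu[OF borel_measurable_polar_fun_mult_cnj]) (simp only: f g)
  ultimately show ?thesis
    unfolding has_bochner_integral_iff by simp
qed

text \<open>
  Equality of \<open>n - m\<close> and \<open>n' - m'\<close> means that both functions have the same parameter \<open>p\<close>.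
\<close>

lemma has_bochner_integral_zernike:
  fixes \<alpha> \<beta> \<gamma> \<eta> :: real
  assumes mn: "(m, n) \<in> L2_index_range \<alpha> \<beta> \<gamma> \<eta>" "(m', n') \<in> L2_index_range \<alpha> \<beta> \<gamma> \<eta>"
    and eq: "n - int m = n' - int m'"
  shows "has_bochner_integral (mu \<alpha> \<beta>) (\<lambda>z. zernike \<alpha> \<beta> \<gamma> \<eta> m n z * cnj (zernike \<alpha> \<beta> \<gamma> \<eta> m' n' z))
    (if m = m' then of_real (pi * fact m / (\<alpha> - 2 * (\<gamma> + real m) - 1) *
          (Gamma (\<alpha> - 2 * \<gamma> - real m) * Gamma (real_of_int n + \<beta> - 2 * \<eta> + 1) /
           Gamma (real_of_int n + \<alpha> + \<beta> - 2 * (\<gamma> + \<eta> + real m)))) else 0)"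
proof -
  define p where "p = of_int n - real m + \<beta> - 2 * \<eta>"
  define N where "N = \<alpha> - 2 * \<gamma> - 1"
  define l where "l = n - int m"
  have p': "p = of_int n' - real m' + \<beta> - 2 * \<eta>"
    using arg_cong[OF eq, of real_of_int] by (simp add: p_def)
  have b: "p + real m = of_int n + \<beta> - 2 * \<eta>" "p + real m' = of_int n' + \<beta> - 2 * \<eta>"
    by (simp add: p_def, simp add: p')
  have c: "N - real k = \<alpha> - 2 * \<gamma> - 1 - real k" for k by (simp add: N_def)
  let ?R = "\<lambda>m. zernike_poly (p + real m) (N - real m) m"
  have z: "zernike \<alpha> \<beta> \<gamma> \<eta> m n z = polar_fun l (- \<gamma> - 1) (- \<eta>) (smult ((- 1) ^ m) (?R m)) z"
      "zernike \<alpha> \<beta> \<gamma> \<eta> m' n' z = polar_fun l (- \<gamma> - 1) (- \<eta>) (smult ((- 1) ^ m') (?R m')) z" if "z \<in> punctured_disc" for z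
    unfolding b c zernike_polar_fun[OF that] l_def eq by simp_all
  have cond: "p + real m > - 1" "p + real m' > - 1" "N > 2 * real m" "N > 2 * real m'"
    using mn by (auto simp: b N_def L2_index_range_def index_range_def)
  have pZ: "p \<in> \<int> \<or> p > - 1"
  proof (cases "2 * \<eta> - \<beta> \<in> \<int>")
    case True
    have "p = of_int n - of_nat m - (2 * \<eta> - \<beta>)" by (simp add: p_def)
    also have "\<dots> \<in> \<int>" by (intro Ints_diff[OF _ True]) auto
    finally show ?thesis ..
  next
    case False
    then show ?thesis using mn(1) by (auto simp: L2_index_range_def p_def)
  qed
  let ?v = "fact m * Gamma (N - real m + 1) * Gamma (p + real m + 1) / ((N - 2 * real m) * Gamma (p + N - real m + 1))"
  have I: "has_bochner_integral lborel 
     (\<lambda>t. indicator {0..1} t * (t powr p * (1 - t) powr (N - 1) * poly (?R m) (t / (1 - t)) * poly (?R m') (t / (1 - t))))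
     (if m = m' then ?v else 0)"
  \<comment> \<open>The integrand is symmetric in both polynomials, so the larger degree may be put first.\<close>
  proof (cases "m' \<le> m")
    case True
    then show ?thesis using has_bochner_integral_zernike_poly[OF cond(1,2) pZ cond(3,4)] by simp
  next
    case False
    then have "has_bochner_integral lborel 
     (\<lambda>t. indicator {0..1} t * (t powr p * (1 - t) powr (N - 1) * poly (?R m') (t / (1 - t)) * poly (?R m) (t / (1 - t)))) 0"
      using has_bochner_integral_zernike_poly[OF cond(2,1) pZ cond(4,3)] by simp
    then show ?thesis using False by (simp add: mult_ac)
  qed
  have e: "of_int l + \<beta> + 2 * - \<eta> = p" "\<alpha> + 2 * (- \<gamma> - 1) = N - 1"
    by (simp_all add: p_def l_def N_def)
  have "has_bochner_integral lborel (\<lambda>t. indicator {0..1} t * (t powr (of_int l + \<beta> + 2 * - \<eta>) * (1 - t) powr (\<alpha> + 2 * (- \<gamma> - 1))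
     * poly (smult ((- 1) ^ m) (?R m)) (t / (1 - t)) * poly (smult ((- 1) ^ m') (?R m')) (t / (1 - t))))
     ((- 1) ^ (m + m') * (if m = m' then ?v else 0))"
    unfolding e using has_bochner_integral_mult_right[OF I, of "(- 1) ^ (m + m')"]
    by (simp add: power_add mult_ac)
  from has_bochner_integral_mu_polar_fun[OF z this]
  have "has_bochner_integral (mu \<alpha> \<beta>) (\<lambda>z. zernike \<alpha> \<beta> \<gamma> \<eta> m n z * cnj (zernike \<alpha> \<beta> \<gamma> \<eta> m' n' z))
     (of_real (pi * ((- 1) ^ (m + m') * (if m = m' then ?v else 0))))" .
  also have "of_real (pi * ((- 1) ^ (m + m') * (if m = m' then ?v else 0))) =
    (if m = m' then complex_of_real (pi * fact m / (\<alpha> - 2 * (\<gamma> + real m) - 1) *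
          (Gamma (\<alpha> - 2 * \<gamma> - real m) * Gamma (real_of_int n + \<beta> - 2 * \<eta> + 1) /
           Gamma (real_of_int n + \<alpha> + \<beta> - 2 * (\<gamma> + \<eta> + real m)))) else 0)"
  proof -
    have "N - real m + 1 = \<alpha> - 2 * \<gamma> - real m" "p + real m + 1 = real_of_int n + \<beta> - 2 * \<eta> + 1"
      "N - 2 * real m = \<alpha> - 2 * (\<gamma> + real m) - 1" "p + N - real m + 1 = real_of_int n + \<alpha> + \<beta> - 2 * (\<gamma> + \<eta> + real m)"
      by (simp_all add: p_def N_def)
    note e = this
    show ?thesis unfolding e by simp
  qed
  finally show ?thesis .
qed

section \<open>The theorem\<close>

lemma zernike_eigenfunction:
  assumes mn: "(m, n) \<in> index_range \<alpha> \<beta> \<gamma> \<eta>"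
  shows "eigenfunction_on punctured_disc (L_plus \<alpha> \<beta> \<gamma> \<eta>)
          (of_real ((real m + 1) * (\<alpha> - 2 * \<gamma> - real m))) (zernike \<alpha> \<beta> \<gamma> \<eta> m n)"
  unfolding eigenfunction_on_def
proof (intro conjI ballI)
  define p where "p = of_int n - real m + \<beta> - 2 * \<eta>"
  define N where "N = \<alpha> - 2 * \<gamma> - 1"
  let ?R = "zernike_poly (p + real m) (N - real m) m"
  have b: "of_int n + \<beta> - 2 * \<eta> = p + real m" "\<alpha> - 2 * \<gamma> - 1 - real m = N - real m"
    by (simp_all add: p_def N_def)
  have z: "zernike \<alpha> \<beta> \<gamma> \<eta> m n z = polar_fun (n - int m) (- \<gamma> - 1) (- \<eta>) (smult ((- 1) ^ m) ?R) z" if "z \<in> punctured_disc" for z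
    unfolding zernike_polar_fun[OF that] b ..
  show "\<exists>z\<in>punctured_disc. zernike \<alpha> \<beta> \<gamma> \<eta> m n z \<noteq> 0"
  proof -
    have "?R \<noteq> 0" by (rule zernike_poly_nonzero) (use mn in \<open>auto simp: index_range_def N_def\<close>)
    then have "finite {x. poly ?R x = 0}" by (rule poly_roots_finite)
    moreover have "infinite {0<..<(1::real)}" by (simp add: infinite_Ioo)
    ultimately have "\<not> {0<..<1} \<subseteq> {x. poly ?R x = 0}"
      using finite_subset by blast
    then obtain x where "x \<in> {0<..<1}" and x1: "poly ?R x \<noteq> 0" by blast
    then have x: "0 < x" "poly ?R x \<noteq> 0" by auto
    define t where "t = x / (1 + x)"
    have t: "0 < t" "t < 1" "t / (1 - t) = x" using x(1) by (auto simp: t_def field_simps)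
    define z where "z = complex_of_real (sqrt t)"
    have zt: "(cmod z)\<^sup>2 = t" "z \<noteq> 0" using t by (auto simp: z_def)
    then have zd: "z \<in> punctured_disc" using t(2) by (auto simp: abs_square_less_1[of "cmod z", simplified, symmetric])
    moreover have "zernike \<alpha> \<beta> \<gamma> \<eta> m n z \<noteq> 0"
      unfolding z[OF zd] polar_fun_def h_squared_modulus zt(1) t(3) using t x zt(2) by simp
    ultimately show ?thesis by blast
  qed
  fix w assume w: "w \<in> punctured_disc"
  have l: "of_int (n - int m) + \<beta> - 2 * \<eta> = p" "\<alpha> - 2 * \<gamma> = N + 1"
    by (simp_all add: p_def N_def)
  have "L_plus \<alpha> \<beta> \<gamma> \<eta> (zernike \<alpha> \<beta> \<gamma> \<eta> m n) w = polar_fun (n - int m) (- \<gamma> - 1) (- \<eta>)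
      (- pderiv ([:p, - (N + 1):] * smult ((- 1) ^ m) ?R + [:0, 1, 1:] * pderiv (smult ((- 1) ^ m) ?R))) w"
    using L_plus_polar_fun[of "zernike \<alpha> \<beta> \<gamma> \<eta> m n" "n - int m" \<gamma> \<eta> "smult ((- 1) ^ m) ?R" w \<alpha> \<beta>, OF z w]
    unfolding l .
  also have "[:p, - (N + 1):] * smult ((- 1) ^ m) ?R + [:0, 1, 1:] * pderiv (smult ((- 1) ^ m) ?R) =
      smult ((- 1) ^ m) ([:p, - (N + 1):] * ?R + [:0, 1, 1:] * pderiv ?R)"
    by (simp only: pderiv_smult mult_smult_right smult_add_right)
  also have "- pderiv \<dots> = smult ((real m + 1) * (N + 1 - real m)) (smult ((- 1) ^ m) ?R)"
    unfolding pderiv_smult zernike_poly_ode by (simp add: mult_ac)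
  finally show "L_plus \<alpha> \<beta> \<gamma> \<eta> (zernike \<alpha> \<beta> \<gamma> \<eta> m n) w = of_real ((real m + 1) * (\<alpha> - 2 * \<gamma> - real m)) * zernike \<alpha> \<beta> \<gamma> \<eta> m n w"
    unfolding z[OF w] l by (simp add: polar_fun_def mult_ac)
qed

theorem theorem2p6:
  fixes \<alpha> \<beta> \<gamma> \<eta> :: real
  assumes "\<alpha> > - 1" and "\<beta> > - 1" and "\<alpha> > 2 * \<gamma> + 1"
  shows
    "(\<forall>(m, n) \<in> index_range \<alpha> \<beta> \<gamma> \<eta>.
        eigenfunction_on punctured_disc (L_plus \<alpha> \<beta> \<gamma> \<eta>)
          (of_real ((real m + 1) * (\<alpha> - 2 * \<gamma> - real m))) (zernike \<alpha> \<beta> \<gamma> \<eta> m n))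
     \<and> (\<forall>(m, n) \<in> L2_index_range \<alpha> \<beta> \<gamma> \<eta>. zernike \<alpha> \<beta> \<gamma> \<eta> m n \<in> L2 \<alpha> \<beta>)
     \<and> (\<forall>(m, n) \<in> L2_index_range \<alpha> \<beta> \<gamma> \<eta>. \<forall>(m', n') \<in> L2_index_range \<alpha> \<beta> \<gamma> \<eta>.
          (m, n) \<noteq> (m', n') \<longrightarrow>
          L2_inner \<alpha> \<beta> (zernike \<alpha> \<beta> \<gamma> \<eta> m n) (zernike \<alpha> \<beta> \<gamma> \<eta> m' n') = 0)
     \<and> (\<forall>(m, n) \<in> L2_index_range \<alpha> \<beta> \<gamma> \<eta>.
          (L2_norm \<alpha> \<beta> (zernike \<alpha> \<beta> \<gamma> \<eta> m n))\<^sup>2 =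
          pi * fact m / (\<alpha> - 2 * (\<gamma> + real m) - 1) *
          (Gamma (\<alpha> - 2 * \<gamma> - real m) * Gamma (real_of_int n + \<beta> - 2 * \<eta> + 1) /
           Gamma (real_of_int n + \<alpha> + \<beta> - 2 * (\<gamma> + \<eta> + real m))))"
proof -
  have mem: "zernike \<alpha> \<beta> \<gamma> \<eta> m n \<in> L2 \<alpha> \<beta>" if mn: "(m, n) \<in> L2_index_range \<alpha> \<beta> \<gamma> \<eta>" for m n
  proof -
    have "integrable (mu \<alpha> \<beta>) (\<lambda>z. complex_of_real ((cmod (zernike \<alpha> \<beta> \<gamma> \<eta> m n z))\<^sup>2))"
      using has_bochner_integral_zernike[OF mn mn refl] unfolding complex_norm_square has_bochner_integral_iff by blast
    then have "integrable (mu \<alpha> \<beta>) (\<lambda>z. (cmod (zernike \<alpha> \<beta> \<gamma> \<eta> m n z))\<^sup>2)"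
      unfolding complex_of_real_integrable_eq .
    moreover have "zernike \<alpha> \<beta> \<gamma> \<eta> m n \<in> borel_measurable (mu \<alpha> \<beta>)"
      by (rule borel_measurable_mu[OF borel_measurable_polar_fun zernike_polar_fun])
    ultimately show ?thesis by (simp add: L2_def)
  qed
  have orth: "L2_inner \<alpha> \<beta> (zernike \<alpha> \<beta> \<gamma> \<eta> m n) (zernike \<alpha> \<beta> \<gamma> \<eta> m' n') = 0"
    if mn: "(m, n) \<in> L2_index_range \<alpha> \<beta> \<gamma> \<eta>" "(m', n') \<in> L2_index_range \<alpha> \<beta> \<gamma> \<eta>" and ne: "(m, n) \<noteq> (m', n')" for m n m' n'
  proof (cases "n - int m = n' - int m'")
    case True
    then have "m \<noteq> m'" using ne by auto
    then show ?thesis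
      using has_bochner_integral_zernike[OF mn True] by (simp add: L2_inner_def has_bochner_integral_iff)
  next
    case False
    then show ?thesis by (intro L2_inner_polar_fun_0[OF zernike_polar_fun zernike_polar_fun])
  qed
  have norm: "(L2_norm \<alpha> \<beta> (zernike \<alpha> \<beta> \<gamma> \<eta> m n))\<^sup>2 =
      pi * fact m / (\<alpha> - 2 * (\<gamma> + real m) - 1) *
          (Gamma (\<alpha> - 2 * \<gamma> - real m) * Gamma (real_of_int n + \<beta> - 2 * \<eta> + 1) /
           Gamma (real_of_int n + \<alpha> + \<beta> - 2 * (\<gamma> + \<eta> + real m)))" (is "_ = ?v")
    if mn: "(m, n) \<in> L2_index_range \<alpha> \<beta> \<gamma> \<eta>" for m n
  proof -
    have "L2_inner \<alpha> \<beta> (zernike \<alpha> \<beta> \<gamma> \<eta> m n) (zernike \<alpha> \<beta> \<gamma> \<eta> m n) = of_real ?v"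
      using has_bochner_integral_zernike[OF mn mn refl] by (simp add: L2_inner_def has_bochner_integral_iff)
    then have v: "Re (L2_inner \<alpha> \<beta> (zernike \<alpha> \<beta> \<gamma> \<eta> m n) (zernike \<alpha> \<beta> \<gamma> \<eta> m n)) = ?v" by simp
    have "?v \<ge> 0"
      unfolding v[symmetric] L2_inner_def complex_norm_square[symmetric] integral_complex_of_real by simp
    then show "(L2_norm \<alpha> \<beta> (zernike \<alpha> \<beta> \<gamma> \<eta> m n))\<^sup>2 = ?v"
      unfolding L2_norm_def v by simp
  qed
  show ?thesis
    using zernike_eigenfunction mem orth norm by blast
qed

end
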